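(* Consider the single-period mean field game with data $(\xi,Z,b,L,G)$ described in the context, under the standing assumptions (i)–(iii) listed there. If the terminal cost $G$ is Lasry–Lions monotone, i.e. $$\int_{\mathbb R^d}\big(G(x,m^1)-G(x,m^2)\big)(m^1-m^2)(dx)\ge0\quad\text{for all }m^1,m^2\in\mathcal P_p(\mathbb R^d),$$ then the single-period mean field game admits at most one mean field equilibrium.
   Context: Notation: $d\ge1$, $p\in(1,\infty)$, $q\in[1,p]$ and $\delta>0$ are fixed; $A\subseteq\mathbb R^d$ is closed and convex with $0\in A$. $\mathcal P_r(\mathbb R^d)$ is the set of Borel probability measures on $\mathbb R^d$ with finite $r$-th moment and $\|\mu\|_r:=(\int|x|^r\mu(dx))^{1/r}$. For $K\ge0$, $\mathcal P_p(\mathbb R^d,K):=\{m\in\mathcal P_p(\mathbb R^d):\int|z|^pm(dz)\le K\}$, endowed with the topology of the Wasserstein distance $\mathcal W_1$. The functions are $b:\mathbb R^d\times A\times\mathcal P_p(\mathbb R^d)\to\mathbb R^d$, $L:\mathbb R^d\times A\times\mathcal P_p(\mathbb R^d)\to\mathbb R$, $G:\mathbb R^d\times\mathcal P_p(\mathbb R^d)\to\mathbb R$. Game: $(\Omega,\mathcal F,\mathbb P)$ is a complete probability space carrying independent $\mathbb R^d$-valued random variables $\xi,Z\in\mathbb L^p$ and a further independent uniformly distributed random variable. $\mathcal F_0$ is the $\mathbb P$-completion of $\sigma(\xi)$, and $m_\xi$ is the law of $\xi$. The set $\mathcal A_S(\xi)$ of admissible controls consists of all $\mathcal F_0$-measurable,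 $p$-integrable, $A$-valued random variables $\alpha$ (identified up to $\mathbb P$-a.s. equality). For $\alpha\in\mathcal A_S(\xi)$ the state is $X^\alpha:=\xi+b(\xi,\alpha,m_\xi)\delta+Z$, and for $m\in\mathcal P_p(\mathbb R^d)$ the cost is $J_m(\alpha):=\mathbb E[L(\xi,\alpha,m_\xi)\delta+G(X^\alpha,m)]\in\mathbb R\cup\{+\infty\}$. A mean field equilibrium (MFE) is a pair $(\alpha,m)$ with $m\in\mathcal P_p(\mathbb R^d)$, $\alpha\in\mathcal A_S(\xi)$ a minimizer of $J_m$ over $\mathcal A_S(\xi)$, and $\mathbb P\circ(X^\alpha)^{-1}=m$. Standing assumptions: (i) $b$ is continuous on $\mathbb R^d\times A\times \mathcal P_p(\mathbb R^d,K)$, and $|b(x,a,\mu)|\le C_b(1+|x|+|a|+\|\mu\|_1)$ for all $(x,a,\mu)$ and some $C_b\ge 1$. (ii) $L$ and $G$ are continuous on $\mathbb R^d\times A\times\mathcal P_p(\mathbb R^d,K)$ and $\mathbb R^d\times\mathcal P_p(\mathbb R^d,K)$, respectively, and for all $(x,a,\mu)\in\mathbb R^d\times A\times\mathcal P_p(\mathbb R^d)$ and some $C_G,C_L\ge0$, $c_L>0$: $-C_G\le G(x,\mu)\le C_G(1+|x|^q)$, $c_L(|a|^p-1)\le L(x,a,\mu)$, $L(x,0,\mu)\le C_L(1+|x|^q+\|\mu\|_q^q)$. (iii) For all $x\in\mathbb R^d$ and $m,\mu\in\mathcal P_p(\mathbb R^d)$ there exists a unique minimizer of $\inf_{a\in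 A}\big(L(x,a,\mu)\delta+\mathbb E[G(x+b(x,a,\mu)\delta+Z,m)]\big)$. Here $K:=4^p\big(2+\mathbb E[|\xi|^p]+\tfrac{1}{c_L\delta}(C_J+C_G)+\mathbb E[|Z|^p]\big)$ with $C_J:=2\max(C_L,16^{q}C_b\vee 1)(1+\mathbb E[|\xi|^q]+\mathbb E[|Z|^q])$. *)

theory Defs
  imports "HOL-Probability.Probability"
begin

section \<open>Borel probability measures with finite moments\<close>

definition prob_moment :: "real \<Rightarrow> (real ^ 'd) measure set" where
  "prob_moment r = {\<mu>. prob_space \<mu> \<and> sets \<mu> = sets borel \<and> integrable \<mu> (\<lambda>x. norm x powr r)}"

definition moment_norm :: "real \<Rightarrow> (real ^ 'd) measure \<Rightarrow> real" where
  "moment_norm r \<mu> = (\<integral>x. norm x powr r \<partial>\<mu>) powr (1 / r)"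

definition prob_moment_le :: "real \<Rightarrow> real \<Rightarrow> (real ^ 'd) measure set" where
  "prob_moment_le p K = {m \<in> prob_moment p. (\<integral>z. norm z powr p \<partial>m) \<le> K}"

definition couplings ::
  "(real ^ 'd) measure \<Rightarrow> (real ^ 'd) measure \<Rightarrow> ((real ^ 'd) \<times> (real ^ 'd)) measure set" where
  "couplings \<mu> \<nu> = {\<pi>. sets \<pi> = sets (borel \<Otimes>\<^sub>M borel) \<and> distr \<pi> borel fst = \<mu> \<and> distr \<pi> borel snd = \<nu>}"

definition wasserstein1 :: "(real ^ 'd) measure \<Rightarrow> (real ^ 'd) measure \<Rightarrow> ennreal" where
  "wasserstein1 \<mu> \<nu> = (INF \<pi>\<in>couplings \<mu> \<nu>. \<integral>\<^sup>+z. ennreal (dist (fst z) (snd z)) \<partial>\<pi>)"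

text \<open>The topology of the Wasserstein distance on a set \<open>S\<close> of measures: a set is open iff it contains
  a \<open>wasserstein1\<close>-ball (relative to \<open>S\<close>) around each of its points.\<close>

definition W1_topology :: "(real ^ 'd) measure set \<Rightarrow> (real ^ 'd) measure topology" where
  "W1_topology S = topology (\<lambda>U. U \<subseteq> S \<and>
     (\<forall>\<mu>\<in>U. \<exists>e>0. \<forall>\<nu>\<in>S. wasserstein1 \<mu> \<nu> < ennreal e \<longrightarrow> \<nu> \<in> U))"

lemma openin_W1_topology:
  "openin (W1_topology S) U \<longleftrightarrow>
     U \<subseteq> S \<and> (\<forall>\<mu>\<in>U. \<exists>e>0. \<forall>\<nu>\<in>S. wasserstein1 \<mu> \<nu> < ennreal e \<longrightarrow> \<nu> \<in> U)"
proof -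
  define near where "near \<mu> U \<longleftrightarrow> (\<exists>e>0. \<forall>\<nu>\<in>S. wasserstein1 \<mu> \<nu> < ennreal e \<longrightarrow> \<nu> \<in> U)" for \<mu> U
  have mono: "near \<mu> V" if U: "near \<mu> U" and UV: "U \<subseteq> V" for \<mu> U V
  proof -
    from U obtain e where e: "e > 0"
      "\<And>\<nu>. \<nu> \<in> S \<Longrightarrow> wasserstein1 \<mu> \<nu> < ennreal e \<Longrightarrow> \<nu> \<in> U"
      unfolding near_def by auto
    show ?thesis
      unfolding near_def
      using e(1) subsetD[OF UV e(2)] by auto
  qed
  have int: "near \<mu> (U \<inter> V)" if U: "near \<mu> U" and V: "near \<mu> V" for \<mu> U V
  proof -
    from U obtain e1 where e1: "e1 > 0"
      "\<And>\<nu>. \<nu> \<in> S \<Longrightarrow> wasserstein1 \<mu> \<nu> < ennreal e1 \<Longrightarrow> \<nu> \<in> U"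
      unfolding near_def by auto
    from V obtain e2 where e2: "e2 > 0"
      "\<And>\<nu>. \<nu> \<in> S \<Longrightarrow> wasserstein1 \<mu> \<nu> < ennreal e2 \<Longrightarrow> \<nu> \<in> V"
      unfolding near_def by auto
    have le: "ennreal (min e1 e2) \<le> ennreal e1" "ennreal (min e1 e2) \<le> ennreal e2"
      by (rule ennreal_leI, simp)+
    have *: "\<nu> \<in> U \<inter> V" if "\<nu> \<in> S" "wasserstein1 \<mu> \<nu> < ennreal (min e1 e2)" for \<nu>
      using e1(2)[OF that(1) order_less_le_trans[OF that(2) le(1)]]
        e2(2)[OF that(1) order_less_le_trans[OF that(2) le(2)]] by (rule IntI)
    have "min e1 e2 > 0"
      using e1(1) e2(1) by simp
    then have "min e1 e2 > 0 \<and>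
        (\<forall>\<nu>\<in>S. wasserstein1 \<mu> \<nu> < ennreal (min e1 e2) \<longrightarrow> \<nu> \<in> U \<inter> V)"
      using * by simp
    then show ?thesis
      unfolding near_def by (rule exI)
  qed
  have "istopology (\<lambda>U. U \<subseteq> S \<and> (\<forall>\<mu>\<in>U. near \<mu> U))"
    unfolding istopology_def
  proof (intro conjI allI impI)
    fix \<K> assume \<K>: "\<forall>U\<in>\<K>. U \<subseteq> S \<and> (\<forall>\<mu>\<in>U. near \<mu> U)"
    show "\<Union>\<K> \<subseteq> S" using \<K> by blast
    show "\<forall>\<mu>\<in>\<Union>\<K>. near \<mu> (\<Union>\<K>)"
    proof
      fix \<mu> assume "\<mu> \<in> \<Union>\<K>"
      then obtain U where "U \<in> \<K>" "\<mu> \<in> U" by blast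
      with \<K> have "near \<mu> U" by blast
      then show "near \<mu> (\<Union>\<K>)"
        using Union_upper[OF \<open>U \<in> \<K>\<close>] by (rule mono)
    qed
  qed (auto intro: int)
  then have "openin (W1_topology S) = (\<lambda>U. U \<subseteq> S \<and> (\<forall>\<mu>\<in>U. near \<mu> U))"
    unfolding W1_topology_def near_def by (rule topology_inverse')
  then show ?thesis
    by (simp only: near_def)
qed

lemma topspace_W1_topology: "topspace (W1_topology S) = S"
proof (rule subset_antisym)
  have "openin (W1_topology S) S"
    unfolding openin_W1_topology by (intro conjI subset_refl ballI exI[of _ "1::real"] impI zero_less_one)
  then show "S \<subseteq> topspace (W1_topology S)"
    by (rule openin_subset)
  show "topspace (W1_topology S) \<subseteq> S"
    by (rule conjunct1[OF openin_topspace[of "W1_topology S", THEN iffD1[OF openin_W1_topology]]])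
qed

section \<open>The single-period mean field game\<close>

text \<open>Functions with domain \<open>A\<close> or a set of measures are total in HOL; their values outside these
  sets are never used.\<close>

definition mfg_C_J ::
  "real \<Rightarrow> real \<Rightarrow> real \<Rightarrow> 'w measure \<Rightarrow> ('w \<Rightarrow> real ^ 'd) \<Rightarrow> ('w \<Rightarrow> real ^ 'd) \<Rightarrow> real" where
  "mfg_C_J q C_b C_L M \<xi> Z = 2 * max C_L (max (16 powr q * C_b) 1) *
     (1 + (\<integral>\<omega>. norm (\<xi> \<omega>) powr q \<partial>M) + (\<integral>\<omega>. norm (Z \<omega>) powr q \<partial>M))"

definition mfg_K ::
  "real \<Rightarrow> real \<Rightarrow> real \<Rightarrow> real \<Rightarrow> real \<Rightarrow> real \<Rightarrow> real \<Rightarrow>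
   'w measure \<Rightarrow> ('w \<Rightarrow> real ^ 'd) \<Rightarrow> ('w \<Rightarrow> real ^ 'd) \<Rightarrow> real" where
  "mfg_K p q \<delta> C_b C_G C_L c_L M \<xi> Z = 4 powr p *
     (2 + (\<integral>\<omega>. norm (\<xi> \<omega>) powr p \<partial>M)
        + 1 / (c_L * \<delta>) * (mfg_C_J q C_b C_L M \<xi> Z + C_G)
        + (\<integral>\<omega>. norm (Z \<omega>) powr p \<partial>M))"

text \<open>The \<open>M\<close>-completion of the sigma-algebra generated by \<open>\<xi>\<close>: all null sets of \<open>M\<close> are adjoined.
  Only the measurable sets of the following measure are used.\<close>

definition initial_algebra :: "'w measure \<Rightarrow> ('w \<Rightarrow> real ^ 'd) \<Rightarrow> 'w measure" where
  "initial_algebra M \<xi> =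
     sigma (space M) ({\<xi> -` B \<inter> space M | B. B \<in> sets borel} \<union> null_sets M)"

text \<open>Representatives of admissible controls; almost surely equal ones are identified only in
  statements about them.\<close>

definition admissible ::
  "(real ^ 'd) set \<Rightarrow> real \<Rightarrow> 'w measure \<Rightarrow> ('w \<Rightarrow> real ^ 'd) \<Rightarrow> ('w \<Rightarrow> real ^ 'd) set" where
  "admissible A p M \<xi> = {\<alpha>. \<alpha> \<in> measurable (initial_algebra M \<xi>) borel \<and>
     (\<forall>\<omega>\<in>space M. \<alpha> \<omega> \<in> A) \<and> integrable M (\<lambda>\<omega>. norm (\<alpha> \<omega>) powr p)}"

definition controlled_state ::
  "real \<Rightarrow> 'w measure \<Rightarrow> ('w \<Rightarrow> real ^ 'd) \<Rightarrow> ('w \<Rightarrow> real ^ 'd) \<Rightarrow>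
   (real ^ 'd \<Rightarrow> real ^ 'd \<Rightarrow> (real ^ 'd) measure \<Rightarrow> real ^ 'd) \<Rightarrow>
   ('w \<Rightarrow> real ^ 'd) \<Rightarrow> 'w \<Rightarrow> real ^ 'd" where
  "controlled_state \<delta> M \<xi> Z b \<alpha> \<omega> =
     \<xi> \<omega> + \<delta> *\<^sub>R b (\<xi> \<omega>) (\<alpha> \<omega>) (distr M borel \<xi>) + Z \<omega>"

text \<open>Expectation of a random variable whose negative part is integrable, with values in
  \<open>(-\<infinity>, \<infinity>]\<close>; \<open>ennreal\<close> maps negative numbers to \<open>0\<close>, so the two terms are the
  expectations of the positive and of the negative part.\<close>

definition ext_expectation :: "'w measure \<Rightarrow> ('w \<Rightarrow> real) \<Rightarrow> ereal" where
  "ext_expectation M f =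
     enn2ereal (\<integral>\<^sup>+\<omega>. ennreal (f \<omega>) \<partial>M) - enn2ereal (\<integral>\<^sup>+\<omega>. ennreal (- f \<omega>) \<partial>M)"

definition mfg_cost ::
  "real \<Rightarrow> 'w measure \<Rightarrow> ('w \<Rightarrow> real ^ 'd) \<Rightarrow> ('w \<Rightarrow> real ^ 'd) \<Rightarrow>
   (real ^ 'd \<Rightarrow> real ^ 'd \<Rightarrow> (real ^ 'd) measure \<Rightarrow> real ^ 'd) \<Rightarrow>
   (real ^ 'd \<Rightarrow> real ^ 'd \<Rightarrow> (real ^ 'd) measure \<Rightarrow> real) \<Rightarrow>
   (real ^ 'd \<Rightarrow> (real ^ 'd) measure \<Rightarrow> real) \<Rightarrow>
   (real ^ 'd) measure \<Rightarrow> ('w \<Rightarrow> real ^ 'd) \<Rightarrow> ereal" where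
  "mfg_cost \<delta> M \<xi> Z b L G m \<alpha> = ext_expectation M
     (\<lambda>\<omega>. L (\<xi> \<omega>) (\<alpha> \<omega>) (distr M borel \<xi>) * \<delta> + G (controlled_state \<delta> M \<xi> Z b \<alpha> \<omega>) m)"

definition mean_field_equilibrium ::
  "(real ^ 'd) set \<Rightarrow> real \<Rightarrow> real \<Rightarrow> 'w measure \<Rightarrow> ('w \<Rightarrow> real ^ 'd) \<Rightarrow> ('w \<Rightarrow> real ^ 'd) \<Rightarrow>
   (real ^ 'd \<Rightarrow> real ^ 'd \<Rightarrow> (real ^ 'd) measure \<Rightarrow> real ^ 'd) \<Rightarrow>
   (real ^ 'd \<Rightarrow> real ^ 'd \<Rightarrow> (real ^ 'd) measure \<Rightarrow> real) \<Rightarrow>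
   (real ^ 'd \<Rightarrow> (real ^ 'd) measure \<Rightarrow> real) \<Rightarrow>
   ('w \<Rightarrow> real ^ 'd) \<Rightarrow> (real ^ 'd) measure \<Rightarrow> bool" where
  "mean_field_equilibrium A p \<delta> M \<xi> Z b L G \<alpha> m \<longleftrightarrow>
     m \<in> prob_moment p \<and>
     is_arg_min (mfg_cost \<delta> M \<xi> Z b L G m) (\<lambda>\<beta>. \<beta> \<in> admissible A p M \<xi>) \<alpha> \<and>
     distr M borel (controlled_state \<delta> M \<xi> Z b \<alpha>) = m"

definition lasry_lions_monotone ::
  "real \<Rightarrow> (real ^ 'd \<Rightarrow> (real ^ 'd) measure \<Rightarrow> real) \<Rightarrow> bool" where
  "lasry_lions_monotone p G \<longleftrightarrow> (\<forall>m1\<in>prob_moment p. \<forall>m2\<in>prob_moment p.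
     (\<integral>x. G x m1 - G x m2 \<partial>m1) - (\<integral>x. G x m1 - G x m2 \<partial>m2) \<ge> 0)"

end

theory Submission
  imports Defs
begin

text \<open>
  Freezing the state and the action at time \<open>0\<close>, the cost of a control \<open>\<alpha>\<close> against \<open>m\<close> is
  \<open>E[F\<^sub>m(\<xi>, \<alpha>)]\<close>, where \<open>F\<^sub>m(x, a)\<close> is the function minimized in (iii). A control that is optimal
  against \<open>m\<close> minimizes \<open>F\<^sub>m(\<xi>, \<cdot>)\<close> almost surely, so that there is at most one such control.
  Adding the optimality inequalities of two equilibria and comparing with Lasry--Lions
  monotonicity forces equalities; hence each of the two controls is optimal against \<open>m\<^sub>1\<close>.

  The constant \<open>K\<close> need not bound the \<open>p\<close>-th moment of an equilibrium law \<open>m\<close> (the drift enters the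
  state with the factors \<open>\<delta>\<close> and \<open>C\<^sub>b\<close>, but not \<open>K\<close> in the corresponding powers), so \<open>G(\<cdot>, m)\<close>
  cannot be taken to be continuous and pointwise optimality requires a measurable selection
  theorem: a Borel set with a projection of positive outer measure admits a Borel selection on a
  set of positive measure.
\<close>

section \<open>Analytic sets and measurable selection\<close>

text \<open>Projections of closed sets along the Baire space, rather than continuous images of it:
  closure under countable unions and intersections then becomes a matter of recoding
  sequences.\<close>

definition analytic_set :: "'z::topological_space set \<Rightarrow> bool" where
  "analytic_set S \<longleftrightarrow> (\<exists>C :: ((nat \<Rightarrow> nat) \<times> 'z) set. closed C \<and> S = snd ` C)"

lemma closed_imp_analytic_set:
  assumes "closed S"
  shows "analytic_set S"
  unfolding analytic_set_def
  by (rule exI[of _ "UNIV \<times> S"]) (auto intro: closed_Times assms)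

text \<open>The head of a sequence names the index \<open>n\<close>, and its tail witnesses
  membership in \<open>S n\<close>.\<close>

lemma analytic_set_UN:
  fixes S :: "nat \<Rightarrow> 'z::topological_space set"
  assumes "\<And>n. analytic_set (S n)"
  shows "analytic_set (\<Union>n. S n)"
proof -
  from assms obtain C :: "nat \<Rightarrow> ((nat \<Rightarrow> nat) \<times> 'z) set"
    where C: "\<And>n. closed (C n)" "\<And>n. S n = snd ` C n"
    unfolding analytic_set_def by metis
  define sh :: "((nat \<Rightarrow> nat) \<times> 'z) \<Rightarrow> ((nat \<Rightarrow> nat) \<times> 'z)"
    where "sh = (\<lambda>p. (\<lambda>k. fst p (Suc k), snd p))"
  define D where "D = {p. sh p \<in> C (fst p 0)}"
  have sh: "continuous_on UNIV sh"
    unfolding sh_def by (intro continuous_intros continuous_on_product_then_coordinatewise)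
  have hd: "continuous_on UNIV (\<lambda>p :: (nat \<Rightarrow> nat) \<times> 'z. fst p 0)"
    by (intro continuous_intros continuous_on_product_then_coordinatewise)
  \<comment> \<open>The head takes values in a discrete space, so \<open>D\<close> is closed
    although the condition on the tail varies with the head.\<close>
  have "- D = (\<Union>n. (\<lambda>p. fst p 0) -` {n} \<inter> sh -` (- C n))"
    unfolding D_def by auto
  moreover have "open ((\<lambda>p :: (nat \<Rightarrow> nat) \<times> 'z. fst p 0) -` {n} \<inter> sh -` (- C n))" for n
    using C(1) by (intro open_Int open_vimage[OF _ hd] open_vimage[OF _ sh]) (auto simp: discrete_topology_class.open_discrete)
  ultimately have "closed D"
    unfolding closed_def by auto
  moreover have "(\<Union>n. S n) = snd ` D"
  proof (intro equalityI subsetI)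
    fix z assume "z \<in> (\<Union>n. S n)"
    then obtain n \<sigma> where "(\<sigma>, z) \<in> C n" using C(2) by force
    then have "(case_nat n \<sigma>, z) \<in> D" by (simp add: D_def sh_def)
    then show "z \<in> snd ` D" by force
  next
    fix z assume "z \<in> snd ` D"
    then show "z \<in> (\<Union>n. S n)" using C(2) by (force simp: D_def sh_def)
  qed
  ultimately show ?thesis unfolding analytic_set_def by blast
qed

text \<open>One sequence carries the witnesses for all \<open>n\<close> at once: the
  \<open>n\<close>-th witness is read off along the positions
  \<open>prod_encode (n, k)\<close>.\<close>

lemma analytic_set_INT:
  fixes S :: "nat \<Rightarrow> 'z::topological_space set"
  assumes "\<And>n. analytic_set (S n)"
  shows "analytic_set (\<Inter>n. S n)"
proof -
  from assms obtain C :: "nat \<Rightarrow> ((nat \<Rightarrow> nat) \<times> 'z) set"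
    where C: "\<And>n. closed (C n)" "\<And>n. S n = snd ` C n"
    unfolding analytic_set_def by metis
  define pr :: "nat \<Rightarrow> ((nat \<Rightarrow> nat) \<times> 'z) \<Rightarrow> ((nat \<Rightarrow> nat) \<times> 'z)"
    where "pr n = (\<lambda>p. (\<lambda>k. fst p (prod_encode (n, k)), snd p))" for n
  define D where "D = (\<Inter>n. pr n -` C n)"
  have "continuous_on UNIV (pr n)" for n
    unfolding pr_def by (intro continuous_intros continuous_on_product_then_coordinatewise)
  then have "closed D"
    unfolding D_def using C(1) by (intro closed_INT ballI closed_vimage) auto
  moreover have "(\<Inter>n. S n) = snd ` D"
  proof (intro equalityI subsetI)
    fix z assume "z \<in> (\<Inter>n. S n)"
    then have "\<exists>\<sigma>. (\<sigma>, z) \<in> C n" for n using C(2) by force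
    then obtain \<sigma> where \<sigma>: "\<And>n. (\<sigma> n, z) \<in> C n" by metis
    have "(\<lambda>j. \<sigma> (fst (prod_decode j)) (snd (prod_decode j)), z) \<in> D"
      using \<sigma> by (simp add: D_def pr_def)
    then show "z \<in> snd ` D" by force
  next
    fix z assume "z \<in> snd ` D"
    then show "z \<in> (\<Inter>n. S n)" using C(2) by (force simp: D_def pr_def)
  qed
  ultimately show ?thesis unfolding analytic_set_def by blast
qed

lemma borel_imp_analytic_set:
  fixes S :: "'z::metric_space set"
  assumes "S \<in> sets borel"
  shows "analytic_set S"
proof -
  have "S \<in> sigma_sets UNIV {S :: 'z set. closed S}"
    using assms by (simp add: borel_eq_closed)
  \<comment> \<open>Analyticity alone does not pass to complements, so the complement is carried
    through the induction.\<close>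
  then have "analytic_set S \<and> analytic_set (- S)"
  proof induction
    case (Basic S)
    have "fsigma_in euclidean (- S)"
      using Basic by (intro open_imp_fsigma_in metrizable_space_euclidean) (auto simp: open_Compl)
    then obtain F :: "nat \<Rightarrow> 'z set" where "\<And>n. closed (F n)" "\<Union> (range F) = - S"
      unfolding fsigma_in_ascending by auto
    then show ?case
      using analytic_set_UN[of F] closed_imp_analytic_set Basic by auto
  next
    case Empty
    then show ?case by (simp add: closed_imp_analytic_set)
  next
    case (Compl S)
    then show ?case by (simp add: Compl_eq_Diff_UNIV[symmetric])
  next
    case (Union S)
    then show ?case using analytic_set_UN[of S] analytic_set_INT[of "\<lambda>n. - S n"] by simp
  qed
  then show ?thesis by simp
qed

section \<open>Compactness in the Baire space and capacitability\<close>

lemma compact_bounded_nat_functions: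
  fixes n :: "nat \<Rightarrow> nat"
  shows "compact {\<sigma>. \<forall>i. \<sigma> i \<le> n i}"
proof -
  have "compactin (product_topology (\<lambda>i. euclidean) UNIV) (PiE UNIV (\<lambda>i. {..n i}))"
    unfolding compactin_PiE by (simp add: finite_imp_compact)
  then show ?thesis
    by (simp add: euclidean_product_topology PiE_def Pi_def)
qed

lemma tendsto_fun_componentwise:
  fixes f :: "nat \<Rightarrow> 'i \<Rightarrow> 'b::topological_space"
  assumes "\<And>i. (\<lambda>k. f k i) \<longlonglongrightarrow> l i"
  shows "f \<longlonglongrightarrow> l"
proof -
  have "limitin (product_topology (\<lambda>i. euclidean) UNIV) f l sequentially"
    unfolding limitin_componentwise using assms by simp
  then show ?thesis by (simp add: euclidean_product_topology)
qed

text \<open>The proof of Choquet's capacitability theorem: bounding one coordinate of the Baire space after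
  the other loses little outer measure, and what remains in the limit is compact.\<close>

lemma compact_subset_of_borel_projection:
  fixes S :: "('x::euclidean_space \<times> 'y::euclidean_space) set"
  assumes P: "finite_measure P" "sets P = sets borel"
    and S: "S \<in> sets borel" and pos: "\<not> (AE x in P. \<forall>y. (x, y) \<notin> S)"
  obtains K where "compact K" "K \<subseteq> S" "emeasure P (fst ` K) > 0"
proof -
  interpret finite_measure P by fact
  have spP[simp]: "space P = UNIV" using sets_eq_imp_space_eq[OF P(2)] by simp
  obtain C0 :: "((nat \<Rightarrow> nat) \<times> ('x \<times> 'y)) set" where C0: "closed C0" "S = snd ` C0"
    using borel_imp_analytic_set[OF S] unfolding analytic_set_def by auto
  define sh :: "((nat \<Rightarrow> nat) \<times> ('x \<times> 'y)) \<Rightarrow> ((nat \<Rightarrow> nat) \<times> ('x \<times> 'y))"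
    where "sh = (\<lambda>p. (\<lambda>k. fst p (Suc k), snd p))"
  \<comment> \<open>A new head coordinate bounds the norm of the point, so that bounding the
    coordinates of the sequence confines the point to a ball as well.\<close>
  define C where "C = {p. sh p \<in> C0 \<and> norm (snd p) \<le> real (fst p 0)}"
  have coord: "continuous_on UNIV (\<lambda>p :: (nat \<Rightarrow> nat) \<times> ('x \<times> 'y). fst p i)" for i
    by (intro continuous_intros continuous_on_product_then_coordinatewise)
  have coordr: "continuous_on UNIV (\<lambda>p :: (nat \<Rightarrow> nat) \<times> ('x \<times> 'y). real (fst p i))" for i
    by (intro continuous_intros coord)
  have "continuous_on UNIV sh"
    unfolding sh_def by (intro continuous_intros continuous_on_product_then_coordinatewise)
  then have "closed (sh -` C0)" using C0(1) by (rule closed_vimage[rotated])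
  moreover have "closed {p :: (nat \<Rightarrow> nat) \<times> ('x \<times> 'y). norm (snd p) \<le> real (fst p 0)}"
    by (intro closed_Collect_le continuous_intros coordr)
  moreover have "C = sh -` C0 \<inter> {p. norm (snd p) \<le> real (fst p 0)}"
    by (auto simp: C_def)
  ultimately have clC: "closed C" by auto
  have SC: "S = snd ` C"
  proof (intro equalityI subsetI)
    fix z assume "z \<in> S"
    then obtain \<sigma> where \<sigma>: "(\<sigma>, z) \<in> C0" using C0(2) by force
    obtain n :: nat where "norm z \<le> real n" using real_arch_simple by blast
    with \<sigma> have "(case_nat n \<sigma>, z) \<in> C" by (simp add: C_def sh_def)
    then show "z \<in> snd ` C" by force
  next
    fix z assume "z \<in> snd ` C"
    then show "z \<in> S" using C0(2) by (force simp: C_def sh_def)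
  qed
  define \<pi> :: "((nat \<Rightarrow> nat) \<times> ('x \<times> 'y)) \<Rightarrow> 'x" where "\<pi> = (\<lambda>p. fst (snd p))"
  \<comment> \<open>The projection is analytic but possibly not Borel, hence the outer measure. Were
    it zero, a measurable null hull would contain the projection of \<open>S\<close>, against
    \<open>pos\<close>.\<close>
  have "outer_measure_of P (\<pi> ` C) > 0"
  proof (rule ccontr)
    assume "\<not> ?thesis"
    moreover obtain E where E: "E \<in> sets P" "\<pi> ` C \<subseteq> E" "outer_measure_of P (\<pi> ` C) = emeasure P E"
      using outer_measure_of_attain[of "\<pi> ` C" P] by auto
    ultimately have "E \<in> null_sets P" by (auto simp: null_sets_def)
    then have "AE x in P. x \<notin> E" by (rule AE_not_in)
    then have "AE x in P. \<forall>y. (x, y) \<notin> S"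
      by eventually_elim (use E(2) in \<open>force simp: SC \<pi>_def\<close>)
    with pos show False by simp
  qed
  then obtain \<epsilon> where \<epsilon>: "0 < \<epsilon>" "\<epsilon> < outer_measure_of P (\<pi> ` C)"
    using dense by blast
  \<comment> \<open>The outer measure is continuous along increasing sequences of arbitrary sets, so
    a large enough bound on coordinate \<open>k\<close> keeps it above
    \<open>\<epsilon>\<close>.\<close>
  have step: "\<exists>n. \<epsilon> < outer_measure_of P (\<pi> ` (E \<inter> {p. fst p k \<le> n}))"
    if "\<epsilon> < outer_measure_of P (\<pi> ` E)" for E k
  proof -
    have "(SUP n. outer_measure_of P (\<pi> ` (E \<inter> {p. fst p k \<le> n})))
      = outer_measure_of P (\<Union>n. \<pi> ` (E \<inter> {p. fst p k \<le> n}))"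
      by (intro SUP_outer_measure_of_incseq) (auto simp: incseq_def intro!: image_mono)
    also have "(\<Union>n. \<pi> ` (E \<inter> {p. fst p k \<le> n})) = \<pi> ` E"
      by auto
    finally have "\<epsilon> < (SUP n. outer_measure_of P (\<pi> ` (E \<inter> {p. fst p k \<le> n})))"
      using that by simp
    then show ?thesis unfolding less_SUP_iff by blast
  qed
  have "\<exists>E. \<forall>k. \<epsilon> < outer_measure_of P (\<pi> ` E k) \<and> (k = 0 \<longrightarrow> E k = C) \<and>
     (\<exists>n. E (Suc k) = E k \<inter> {p. fst p k \<le> n})"
  proof -
    have "\<exists>E. \<forall>k. (\<epsilon> < outer_measure_of P (\<pi> ` E k) \<and> (k = 0 \<longrightarrow> E k = C)) \<and>
     (\<exists>n. E (Suc k) = E k \<inter> {p. fst p k \<le> n})"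
    proof (rule dependent_nat_choice)
      show "\<exists>E. \<epsilon> < outer_measure_of P (\<pi> ` E) \<and> (0 = (0::nat) \<longrightarrow> E = C)" using \<epsilon> by auto
      fix E and k :: nat assume "\<epsilon> < outer_measure_of P (\<pi> ` E) \<and> (k = 0 \<longrightarrow> E = C)"
      then obtain n where "\<epsilon> < outer_measure_of P (\<pi> ` (E \<inter> {p. fst p k \<le> n}))" using step by blast
      then show "\<exists>E'. (\<epsilon> < outer_measure_of P (\<pi> ` E') \<and> (Suc k = 0 \<longrightarrow> E' = C)) \<and>
          (\<exists>n. E' = E \<inter> {p. fst p k \<le> n})" by auto
    qed
    then show ?thesis by blast
  qed
  then obtain E where E: "\<And>k. \<epsilon> < outer_measure_of P (\<pi> ` E k)" "E 0 = C"
    "\<And>k. \<exists>n. E (Suc k) = E k \<inter> {p. fst p k \<le> n}"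
    by blast
  from E(3) obtain n where n: "\<And>k. E (Suc k) = E k \<inter> {p. fst p k \<le> n k}"
    by metis
  have Ek: "E k = C \<inter> {p. \<forall>i<k. fst p i \<le> n i}" for k
    by (induction k) (auto simp: E(2) n less_Suc_eq)
  \<comment> \<open>The radius comes from the head coordinate: a point of \<open>C\<close> whose
    head is at most \<open>n 0\<close> has norm at most \<open>n 0\<close>.\<close>
  define B where "B = {\<sigma>. \<forall>i. \<sigma> i \<le> n i} \<times> cball (0 :: 'x \<times> 'y) (real (n 0))"
  have "compact B"
    unfolding B_def by (intro compact_Times compact_bounded_nat_functions compact_cball)
  define K where "K = snd ` (C \<inter> B)"
  have "compact K"
    unfolding K_def using \<open>compact B\<close> clC
    by (intro compact_continuous_image continuous_intros closed_Int_compact)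
  moreover have "K \<subseteq> S" by (auto simp: K_def SC)
  moreover have "emeasure P (fst ` K) > 0"
  proof -
    \<comment> \<open>With all coordinates bounded, compactness leads from the closures back to an
      honest projection.\<close>
    have sub: "(\<Inter>k. closure (\<pi> ` E k)) \<subseteq> fst ` K"
    proof
      fix x assume x: "x \<in> (\<Inter>k. closure (\<pi> ` E k))"
      \<comment> \<open>\<open>E (Suc k)\<close> bounds the coordinates up to and including
        \<open>k\<close>; in particular the head is always bounded.\<close>
      have "\<exists>p. p \<in> E (Suc k) \<and> dist (\<pi> p) x < inverse (real (Suc k))" for k
      proof -
        have "x \<in> closure (\<pi> ` E (Suc k))" using x by blast
        moreover have "inverse (real (Suc k)) > 0" by simp
        ultimately obtain y where "y \<in> \<pi> ` E (Suc k)" "dist y x < inverse (real (Suc k))"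
          unfolding closure_approachable by blast
        then show ?thesis by blast
      qed
      then obtain f where f: "\<And>k. f k \<in> E (Suc k)" "\<And>k. dist (\<pi> (f k)) x < inverse (real (Suc k))"
        by metis
      \<comment> \<open>\<open>f k\<close> obeys the bounds only up to coordinate \<open>k\<close>.
        Zeroing the rest puts it into \<open>B\<close>, and each fixed coordinate is eventually
        unaffected, so \<open>f\<close> and \<open>g\<close> have the same limit along
        \<open>r\<close>.\<close>
      define g where "g k = (\<lambda>i. if i \<le> k then fst (f k) i else 0, snd (f k))" for k
      have gB: "g k \<in> B" for k
      proof -
        have "norm (snd (f k)) \<le> real (fst (f k) 0)" "fst (f k) 0 \<le> n 0"
          using f(1)[of k] by (auto simp: Ek C_def)
        then have "norm (snd (f k)) \<le> real (n 0)" by simp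
        then show ?thesis using f(1)[of k] by (auto simp: B_def g_def Ek less_Suc_eq_le)
      qed
      have "seq_compact B" using \<open>compact B\<close> by (rule compact_imp_seq_compact)
      then obtain l r where l: "l \<in> B" "strict_mono r" "(g \<circ> r) \<longlonglongrightarrow> l"
        using gB unfolding seq_compact_def by metis
      have l1: "(\<lambda>k. fst (f (r k)) i) \<longlonglongrightarrow> fst l i" for i
      proof -
        have "(\<lambda>k. fst ((g \<circ> r) k)) \<longlonglongrightarrow> fst l" using l(3) by (rule tendsto_fst)
        then have *: "(\<lambda>k. fst ((g \<circ> r) k) i) \<longlonglongrightarrow> fst l i"
          using continuous_on_tendsto_compose[OF continuous_on_product_coordinates[of i]] by auto
        have "eventually (\<lambda>k. i \<le> r k) sequentially"
          using eventually_ge_at_top[of i]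
          by eventually_elim (use seq_suble[OF l(2)] order_trans in blast)
        then have "eventually (\<lambda>k. fst ((g \<circ> r) k) i = fst (f (r k)) i) sequentially"
          by eventually_elim (simp add: g_def)
        with * show ?thesis by (rule Lim_transform_eventually)
      qed
      have l2: "(\<lambda>k. snd (f (r k))) \<longlonglongrightarrow> snd l"
        using tendsto_snd[OF l(3)] by (simp add: g_def o_def)
      have "(\<lambda>k. (fst (f (r k)), snd (f (r k)))) \<longlonglongrightarrow> (fst l, snd l)"
        by (intro tendsto_Pair tendsto_fun_componentwise l1 l2)
      then have "(\<lambda>k. f (r k)) \<longlonglongrightarrow> l" by simp
      moreover have "f (r k) \<in> C" for k using f(1)[of "r k"] by (simp add: Ek)
      ultimately have "l \<in> C" 
        using clC by (intro Lim_in_closed_set[of C "\<lambda>k. f (r k)" sequentially]) auto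
      moreover have "fst (snd l) = x"
      proof -
        have "(\<lambda>k. \<pi> (f k)) \<longlonglongrightarrow> x"
          unfolding tendsto_dist_iff[of _ x]
          by (rule Lim_null_comparison[OF _ LIMSEQ_inverse_real_of_nat])
             (use f(2) in \<open>auto intro!: always_eventually less_imp_le\<close>)
        then have "(\<lambda>k. \<pi> (f (r k))) \<longlonglongrightarrow> x"
          using l(2) LIMSEQ_subseq_LIMSEQ[of "\<lambda>k. \<pi> (f k)"] by (simp add: o_def)
        moreover have "(\<lambda>k. \<pi> (f (r k))) \<longlonglongrightarrow> fst (snd l)"
          unfolding \<pi>_def by (intro tendsto_fst l2)
        ultimately show ?thesis by (metis LIMSEQ_unique)
      qed
      ultimately show "x \<in> fst ` K" using l(1) unfolding K_def by force
    qed
    have meas: "closure (\<pi> ` E k) \<in> sets P" for k by (simp add: P(2))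
    \<comment> \<open>The closures are measurable and decreasing, and \<open>P\<close> is finite, so
      the lower bound \<open>\<epsilon>\<close> survives in their intersection.\<close>
    have "\<epsilon> \<le> (INF k. emeasure P (closure (\<pi> ` E k)))"
    proof (rule INF_greatest)
      fix k
      have "\<epsilon> \<le> outer_measure_of P (\<pi> ` E k)" using E(1)[of k] by simp
      also have "\<dots> \<le> outer_measure_of P (closure (\<pi> ` E k))"
        by (intro outer_measure_of_mono closure_subset)
      finally show "\<epsilon> \<le> emeasure P (closure (\<pi> ` E k))" using meas by simp
    qed
    also have "\<dots> = emeasure P (\<Inter>k. closure (\<pi> ` E k))"
      by (intro INF_emeasure_decseq') 
         (use meas in \<open>auto simp: decseq_Suc_iff Ek intro!: closure_mono image_mono\<close>)
    also have "\<dots> \<le> emeasure P (fst ` K)"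
    proof (rule emeasure_mono[OF sub])
      have "compact (fst ` K)" using \<open>compact K\<close> by (intro compact_continuous_image continuous_intros)
      then show "fst ` K \<in> sets P" by (simp add: P(2) borel_compact)
    qed
    finally show ?thesis using \<epsilon>(1) by simp
  qed
  ultimately show ?thesis by (rule that)
qed

section \<open>Borel selection from compact sets\<close>

text \<open>Minimizing the coordinates one after the other shrinks the sections of a compact set to single
  points; this is one step, with \<open>r\<close> ranging over the rationals to keep the intersection countable.\<close>

lemma argmin_borel_hits:
  fixes M :: "'x::topological_space \<Rightarrow> 'y::metric_space set" and g :: "'y \<Rightarrow> real"
  assumes M: "\<And>x. compact (M x)" "\<And>C. closed C \<Longrightarrow> {x. M x \<inter> C \<noteq> {}} \<in> sets borel"
    and g: "continuous_on UNIV g"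
  defines "N \<equiv> \<lambda>x. {y \<in> M x. \<forall>z\<in>M x. g y \<le> g z}"
  shows "compact (N x)" "closed C \<Longrightarrow> {x. N x \<inter> C \<noteq> {}} \<in> sets borel" "M x \<noteq> {} \<Longrightarrow> N x \<noteq> {}"
proof -
  have cl: "closed {y. g y \<le> r}" for r
    using g by (intro closed_Collect_le continuous_intros)
  have "N x = M x \<inter> (\<Inter>z\<in>M x. {y. g y \<le> g z})" by (auto simp: N_def)
  then show "compact (N x)" using M(1) cl by (auto intro!: compact_Int_closed)
  show "M x \<noteq> {} \<Longrightarrow> N x \<noteq> {}"
    using continuous_attains_inf[OF M(1), of x g] g continuous_on_subset unfolding N_def by blast
  assume C: "closed C"
  \<comment> \<open>By compactness, some minimizer of \<open>g\<close> over \<open>M x\<close> lies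
    in \<open>C\<close> exactly when \<open>M x\<close> meets \<open>C\<close> and every rational
    sublevel set that meets \<open>M x\<close> also meets \<open>M x \<inter> C\<close>.\<close>
  have "{x. N x \<inter> C \<noteq> {}} = {x. M x \<inter> C \<noteq> {}} \<inter>
    (\<Inter>r\<in>\<rat>. - {x. M x \<inter> {y. g y \<le> r} \<noteq> {}} \<union> {x. M x \<inter> (C \<inter> {y. g y \<le> r}) \<noteq> {}})"
    (is "?L = ?R")
  proof (intro equalityI subsetI)
    fix x assume "x \<in> ?L"
    then show "x \<in> ?R" unfolding N_def using order_trans by blast
  next
    fix x assume x: "x \<in> ?R"
    have "compact (M x \<inter> C)" using M(1) C by (intro compact_Int_closed)
    moreover have "continuous_on (M x \<inter> C) g" using g continuous_on_subset by blast
    ultimately obtain y where y: "y \<in> M x \<inter> C" "\<And>z. z \<in> M x \<inter> C \<Longrightarrow> g y \<le> g z"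
      using x continuous_attains_inf[of "M x \<inter> C" g] by blast
    have "g y \<le> g z" if z: "z \<in> M x" for z
    proof (rule ccontr)
      assume "\<not> ?thesis"
      then obtain r where r: "r \<in> \<rat>" "g z < r" "r < g y" using Rats_dense_in_real[of "g z" "g y"] by auto
      then have "M x \<inter> {y. g y \<le> r} \<noteq> {}" using z by force
      then obtain w where "w \<in> M x \<inter> C" "g w \<le> r" using x r(1) by blast
      then show False using y(2)[of w] r(3) by simp
    qed
    then show "x \<in> ?L" using y(1) unfolding N_def by blast
  qed
  also have "\<dots> \<in> sets borel"
    using M(2) C cl by (intro sets.Int sets.countable_INT'' sets.Un sets.compl_sets countable_rat)
      (auto intro!: borel_comp closed_Int)
  finally show "{x. N x \<inter> C \<noteq> {}} \<in> sets borel" .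
qed

text \<open>Minimizing one basis coordinate after another leaves exactly one point in each nonempty
  section. Measurability is carried along by \<open>good\<close>, as Borel measurability of the set
  of \<open>x\<close> whose section meets a given closed set; for one-point sections this becomes
  measurability of the selection.\<close>

lemma borel_selection_of_compact_set:
  fixes K :: "('x::euclidean_space \<times> 'y::euclidean_space) set"
  assumes K: "compact K"
  obtains \<psi> where "\<psi> \<in> borel_measurable borel" "\<And>x. x \<in> fst ` K \<Longrightarrow> (x, \<psi> x) \<in> K"
proof -
  define good where "good M \<longleftrightarrow> (\<forall>x. compact (M x)) \<and>
      (\<forall>C. closed C \<longrightarrow> {x. M x \<inter> C \<noteq> {}} \<in> sets borel)" for M :: "'x \<Rightarrow> 'y set"
  have "\<exists>M. good M \<and> (\<forall>x. M x \<subseteq> {y. (x, y) \<in> K}) \<and> (\<forall>x\<in>fst ` K. M x \<noteq> {}) \<and>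
      (\<forall>x. \<forall>y\<in>M x. \<forall>z\<in>M x. \<forall>i\<in>I. y \<bullet> i = z \<bullet> i)" if "finite I" for I
    using that
  proof induction
    case empty
    define M where "M x = {y. (x, y) \<in> K}" for x
    have "compact (M x)" for x
    proof -
      have "M x = snd ` (K \<inter> ({x} \<times> UNIV))" by (force simp: M_def)
      then show ?thesis using K
        by (auto intro!: compact_continuous_image continuous_intros compact_Int_closed closed_Times)
    qed
    moreover have "{x. M x \<inter> C \<noteq> {}} \<in> sets borel" if "closed C" for C
    proof -
      \<comment> \<open>For the full sections these sets are projections of compact sets, hence
        compact.\<close>
      have "{x. M x \<inter> C \<noteq> {}} = fst ` (K \<inter> (UNIV \<times> C))" by (force simp: M_def)
      moreover have "compact (fst ` (K \<inter> (UNIV \<times> C)))" using K that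
        by (auto intro!: compact_continuous_image continuous_intros compact_Int_closed closed_Times)
      ultimately show ?thesis by (simp add: borel_compact)
    qed
    ultimately show ?case
      by (intro exI[of _ M]) (auto simp: good_def M_def)
  next
    case (insert i I)
    then obtain M where M: "good M" "\<forall>x. M x \<subseteq> {y. (x, y) \<in> K}" "\<forall>x\<in>fst ` K. M x \<noteq> {}"
      "\<forall>x. \<forall>y\<in>M x. \<forall>z\<in>M x. \<forall>i\<in>I. y \<bullet> i = z \<bullet> i" by blast
    define N where "N x = {y \<in> M x. \<forall>z\<in>M x. y \<bullet> i \<le> z \<bullet> i}" for x
    have g: "continuous_on UNIV (\<lambda>y :: 'y. y \<bullet> i)" by (intro continuous_intros)
    have M': "compact (M x)" "closed C \<Longrightarrow> {x. M x \<inter> C \<noteq> {}} \<in> sets borel" for x C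
      using M(1) unfolding good_def by blast+
    note * = argmin_borel_hits[of M "\<lambda>y. y \<bullet> i", OF M' g, folded N_def]
    have "good N" unfolding good_def using *(1,2) by simp
    moreover have "\<forall>x\<in>fst ` K. N x \<noteq> {}" using *(3) M(3) by simp
    moreover have sub: "N x \<subseteq> M x" for x by (auto simp: N_def)
    moreover have "\<forall>x. N x \<subseteq> {y. (x, y) \<in> K}" using sub M(2) by blast
    moreover have "\<forall>x. \<forall>y\<in>N x. \<forall>z\<in>N x. \<forall>j\<in>insert i I. y \<bullet> j = z \<bullet> j"
    proof (intro allI ballI)
      fix x y z j assume yz: "y \<in> N x" "z \<in> N x" and j: "j \<in> insert i I"
      show "y \<bullet> j = z \<bullet> j"
      proof (cases "j = i")
        case True
        then show ?thesis using yz by (auto simp: N_def intro: antisym)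
      next
        case False
        then show ?thesis using M(4) yz sub[of x] j by blast
      qed
    qed
    ultimately show ?case by blast
  qed
  from this[OF finite_Basis] obtain M where M': "good M" "\<forall>x. M x \<subseteq> {y. (x, y) \<in> K}"
    "\<forall>x\<in>fst ` K. M x \<noteq> {}" "\<forall>x. \<forall>y\<in>M x. \<forall>z\<in>M x. \<forall>i\<in>Basis. y \<bullet> i = z \<bullet> i"
    by (elim exE conjE)
  note M = M'(1) M'(2)[rule_format] M'(3)[rule_format] M'(4)[rule_format]
  have single: "y = z" if "y \<in> M x" "z \<in> M x" for x y z
    by (rule euclidean_eqI) (rule M(4)[OF that])
  define \<psi> where "\<psi> x = (if M x = {} then 0 else SOME y. y \<in> M x)" for x
  have mem: "\<psi> x \<in> M x" if "M x \<noteq> {}" for x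
    using that some_in_eq[of "M x"] by (simp add: \<psi>_def)
  have "\<psi> \<in> borel_measurable borel"
    unfolding borel_eq_closed[where 'a='y]
  proof (rule measurable_measure_of)
    fix C :: "'y set" assume "C \<in> {S. closed S}"
    then have C: "closed C" by simp
    \<comment> \<open>The default value 0 off the projection of \<open>K\<close> contributes the
      second set whenever 0 lies in \<open>C\<close>.\<close>
    have "\<psi> -` C \<inter> space borel = {x. M x \<inter> C \<noteq> {}} \<union> (if 0 \<in> C then - {x. M x \<inter> UNIV \<noteq> {}} else {})"
    proof (intro set_eqI)
      fix x
      show "x \<in> \<psi> -` C \<inter> space borel \<longleftrightarrow>
        x \<in> {x. M x \<inter> C \<noteq> {}} \<union> (if 0 \<in> C then - {x. M x \<inter> UNIV \<noteq> {}} else {})"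
      proof (cases "M x = {}")
        case True
        then show ?thesis by (simp add: \<psi>_def)
      next
        case False
        then have "M x = {\<psi> x}" using mem single by blast
        then show ?thesis by simp
      qed
    qed
    also have "\<dots> \<in> sets borel"
    proof -
      have "{x. M x \<inter> C \<noteq> {}} \<in> sets borel" "- {x. M x \<inter> UNIV \<noteq> {}} \<in> sets borel"
        using M(1) C closed_UNIV unfolding good_def by (blast intro: borel_comp)+
      then show ?thesis by (auto intro: sets.Un simp del: Int_UNIV_right)
    qed
    finally show "\<psi> -` C \<inter> space borel \<in> sets borel" .
  qed auto
  moreover have "(x, \<psi> x) \<in> K" if "x \<in> fst ` K" for x
    using mem[OF M(3)[OF that]] M(2) by blast
  ultimately show ?thesis using that by blast
qed

text \<open>A selection over a part of the projection is enough to improve a control on an event of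
  positive probability; the compact set inside \<open>S\<close> supplies it.\<close>

lemma borel_selection_on_positive_measure:
  fixes S :: "('x::euclidean_space \<times> 'y::euclidean_space) set"
  assumes "finite_measure P" "sets P = sets borel" "S \<in> sets borel"
    and "\<not> (AE x in P. \<forall>y. (x, y) \<notin> S)"
  obtains Q \<psi> where "Q \<in> sets borel" "emeasure P Q > 0" "\<psi> \<in> borel_measurable borel"
    "\<And>x. x \<in> Q \<Longrightarrow> (x, \<psi> x) \<in> S"
proof -
  obtain K where K: "compact K" "K \<subseteq> S" "emeasure P (fst ` K) > 0"
    using compact_subset_of_borel_projection[OF assms] .
  obtain \<psi> where \<psi>: "\<psi> \<in> borel_measurable borel" "\<And>x. x \<in> fst ` K \<Longrightarrow> (x, \<psi> x) \<in> K"
    using borel_selection_of_compact_set[OF K(1)] by blast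
  have "compact (fst ` K)" using K(1) by (intro compact_continuous_image continuous_intros)
  then have "fst ` K \<in> sets borel" by (rule borel_compact)
  then show ?thesis using that[OF _ K(3) \<psi>(1)] \<psi>(2) K(2) by blast
qed

section \<open>Optimal controls\<close>

lemma space_initial_algebra [simp]: "space (initial_algebra M \<xi>) = space M"
  unfolding initial_algebra_def by (simp add: space_measure_of_conv)

lemma sets_initial_algebra:
  "sets (initial_algebra M \<xi>) =
     sigma_sets (space M) ({\<xi> -` B \<inter> space M | B. B \<in> sets borel} \<union> null_sets M)"
  unfolding initial_algebra_def
  by (rule sets_measure_of) (auto dest: sets.sets_into_space)

lemma measurable_initial_algebra [measurable]:
  fixes \<xi> :: "'w \<Rightarrow> real ^ 'd"
  shows "\<xi> \<in> borel_measurable (initial_algebra M \<xi>)"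
proof (rule measurableI)
  fix B :: "(real ^ 'd) set" assume "B \<in> sets borel"
  then show "\<xi> -` B \<inter> space (initial_algebra M \<xi>) \<in> sets (initial_algebra M \<xi>)"
    unfolding sets_initial_algebra by (auto intro!: sigma_sets.Basic)
qed simp

text \<open>Both properties hold for the generators and are stable under complements and countable
  unions. Agreement up to a null set is what lets independence of \<open>\<xi>\<close> and
  \<open>Z\<close> pass to the completion.\<close>

lemma initial_algebra_set_AE_eq:
  assumes \<xi>: "\<xi> \<in> borel_measurable M" and E: "E \<in> sets (initial_algebra M \<xi>)"
  shows "E \<in> sets M \<and> (\<exists>B\<in>sets borel. AE \<omega> in M. \<omega> \<in> E \<longleftrightarrow> \<xi> \<omega> \<in> B)"
  using E unfolding sets_initial_algebra
proof induction
  case (Basic E)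
  then show ?case
  proof
    assume "E \<in> {\<xi> -` B \<inter> space M | B. B \<in> sets borel}"
    then obtain B where "B \<in> sets borel" "E = \<xi> -` B \<inter> space M" by blast
    then show ?thesis using \<xi> by (auto intro!: bexI[of _ B] measurable_sets AE_I2)
  next
    assume "E \<in> null_sets M"
    then show ?thesis using AE_not_in[of E M] by (intro conjI bexI[of _ "{}"]) auto
  qed
next
  case Empty
  then show ?case by (intro conjI bexI[of _ "{}"]) auto
next
  case (Compl E)
  then obtain B where B: "B \<in> sets borel" "AE \<omega> in M. \<omega> \<in> E \<longleftrightarrow> \<xi> \<omega> \<in> B" by blast
  from B(2) AE_space have "AE \<omega> in M. \<omega> \<in> space M - E \<longleftrightarrow> \<xi> \<omega> \<in> - B"
    by eventually_elim auto
  then show ?case using Compl B(1) by (intro conjI bexI[of _ "- B"]) auto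
next
  case (Union E)
  then obtain B where B: "\<And>i :: nat. B i \<in> sets borel" "\<And>i. AE \<omega> in M. \<omega> \<in> E i \<longleftrightarrow> \<xi> \<omega> \<in> B i"
    by metis
  have "AE \<omega> in M. \<forall>i. \<omega> \<in> E i \<longleftrightarrow> \<xi> \<omega> \<in> B i" using B(2) by (simp add: AE_all_countable)
  then have "AE \<omega> in M. \<omega> \<in> (\<Union>i. E i) \<longleftrightarrow> \<xi> \<omega> \<in> (\<Union>i. B i)"
    by eventually_elim auto
  then show ?case using Union B(1) by (intro conjI bexI[of _ "\<Union>i. B i"]) auto
qed

lemma measurable_from_initial_algebra:
  assumes "\<xi> \<in> borel_measurable M" "T \<in> measurable (initial_algebra M \<xi>) N"
  shows "T \<in> measurable M N"
  using assms(2) initial_algebra_set_AE_eq[OF assms(1)]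
  by (auto intro!: measurableI dest: measurable_space measurable_sets)

text \<open>Each event of \<open>T\<close> agrees almost surely with an event of
  \<open>\<xi>\<close>, so the probabilities factorize on rectangles, and these determine the
  product measure.\<close>

lemma (in prob_space) distr_Pair_initial_algebra:
  fixes \<xi> :: "'a \<Rightarrow> real ^ 'd" and Z :: "'a \<Rightarrow> 'z::topological_space"
  assumes \<xi>: "\<xi> \<in> borel_measurable M" and Z: "Z \<in> borel_measurable M"
    and T: "T \<in> measurable (initial_algebra M \<xi>) N"
    and indep: "\<And>B C. B \<in> sets borel \<Longrightarrow> C \<in> sets borel \<Longrightarrow>
      prob ((\<xi> -` B \<inter> space M) \<inter> (Z -` C \<inter> space M)) =
      prob (\<xi> -` B \<inter> space M) * prob (Z -` C \<inter> space M)"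
  shows "distr M N T \<Otimes>\<^sub>M distr M borel Z = distr M (N \<Otimes>\<^sub>M borel) (\<lambda>\<omega>. (T \<omega>, Z \<omega>))"
proof (rule pair_measure_eqI)
  note TM = measurable_from_initial_algebra[OF \<xi> T]
  have "prob_space (distr M N T)" using TM by (rule prob_space_distr)
  then show "sigma_finite_measure (distr M N T)" by (simp add: prob_space_imp_sigma_finite)
  have "prob_space (distr M borel Z)" using Z by (rule prob_space_distr)
  then show "sigma_finite_measure (distr M borel Z)" by (simp add: prob_space_imp_sigma_finite)
  show "sets (distr M N T \<Otimes>\<^sub>M distr M borel Z) = sets (distr M (N \<Otimes>\<^sub>M borel) (\<lambda>\<omega>. (T \<omega>, Z \<omega>)))"
    by (simp cong: sets_pair_measure_cong)
  fix A C assume A: "A \<in> sets (distr M N T)" and C: "C \<in> sets (distr M borel Z)"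
  have "T -` A \<inter> space (initial_algebra M \<xi>) \<in> sets (initial_algebra M \<xi>)"
    using T A by (intro measurable_sets) auto
  then obtain B where B: "B \<in> sets borel" "AE \<omega> in M. \<omega> \<in> T -` A \<inter> space M \<longleftrightarrow> \<xi> \<omega> \<in> B"
    using initial_algebra_set_AE_eq[OF \<xi>, of "T -` A \<inter> space M"] by auto
  have [measurable]: "T -` A \<inter> space M \<in> sets M" "Z -` C \<inter> space M \<in> sets M" "\<xi> -` B \<inter> space M \<in> sets M"
    using TM Z \<xi> A C B(1) by (auto intro: measurable_sets)
  have e1: "prob (T -` A \<inter> space M) = prob (\<xi> -` B \<inter> space M)"
    using B(2) AE_space by (intro finite_measure_eq_AE) (auto elim!: eventually_elim2)
  have e2: "prob ((T -` A \<inter> space M) \<inter> (Z -` C \<inter> space M)) =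
      prob ((\<xi> -` B \<inter> space M) \<inter> (Z -` C \<inter> space M))"
    using B(2) AE_space by (intro finite_measure_eq_AE) (auto elim!: eventually_elim2)
  have "(\<lambda>\<omega>. (T \<omega>, Z \<omega>)) -` (A \<times> C) \<inter> space M = (T -` A \<inter> space M) \<inter> (Z -` C \<inter> space M)"
    by auto
  then show "emeasure (distr M N T) A * emeasure (distr M borel Z) C =
      emeasure (distr M (N \<Otimes>\<^sub>M borel) (\<lambda>\<omega>. (T \<omega>, Z \<omega>))) (A \<times> C)"
    using TM Z A C e1 e2 indep[OF B(1), of C]
    by (simp add: emeasure_distr emeasure_eq_measure ennreal_mult')
qed

text \<open>The shift by the lower bound replaces the difference of two integrals by a single
  nonnegative integral, to which Tonelli's theorem applies whether or not it is finite.\<close>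

lemma (in prob_space) ext_expectation_bounded_below:
  assumes f: "f \<in> borel_measurable M" and bound: "\<And>\<omega>. \<omega> \<in> space M \<Longrightarrow> - C \<le> f \<omega>" and C: "0 \<le> C"
  shows "ext_expectation M f = enn2ereal (\<integral>\<^sup>+\<omega>. ennreal (f \<omega> + C) \<partial>M) - ereal C"
proof -
  let ?P = "\<integral>\<^sup>+\<omega>. ennreal (f \<omega>) \<partial>M" and ?N = "\<integral>\<^sup>+\<omega>. ennreal (- f \<omega>) \<partial>M"
    and ?S = "\<integral>\<^sup>+\<omega>. ennreal (f \<omega> + C) \<partial>M"
  have "?N \<le> (\<integral>\<^sup>+\<omega>. ennreal C \<partial>M)"
    using bound by (intro nn_integral_mono ennreal_leI) force
  then have "?N \<le> ennreal C" by (simp add: emeasure_space_1)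
  then obtain n where n: "?N = ennreal n" "0 \<le> n" by (cases ?N) (auto simp: top_unique)
  have "?P + ennreal C = (\<integral>\<^sup>+\<omega>. ennreal (f \<omega>) + ennreal C \<partial>M)"
    using f by (simp add: nn_integral_add emeasure_space_1)
  \<comment> \<open>Pointwise, f^+ + C = (f + C) + f^-. Only nonnegative terms are added, which
    avoids subtracting extended values.\<close>
  also have "\<dots> = (\<integral>\<^sup>+\<omega>. ennreal (f \<omega> + C) + ennreal (- f \<omega>) \<partial>M)"
  proof (intro nn_integral_cong)
    fix \<omega> assume "\<omega> \<in> space M"
    then show "ennreal (f \<omega>) + ennreal C = ennreal (f \<omega> + C) + ennreal (- f \<omega>)"
      using bound[of \<omega>] C by (cases "f \<omega> \<ge> 0") (simp_all add: ennreal_neg flip: ennreal_plus)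
  qed
  also have "\<dots> = ?S + ?N"
    using f by (simp add: nn_integral_add)
  finally have *: "?P + ennreal C = ?S + ?N" .
  show ?thesis
  proof (cases ?P)
    case (real r)
    then obtain s where s: "?S = ennreal s" "0 \<le> s" using * n by (cases ?S) auto
    have "r + C = s + n" using * real s n C by (simp flip: ennreal_plus)
    then show ?thesis unfolding ext_expectation_def
      using real s n by (simp add: enn2ereal_ennreal)
  next
    case top
    then have "?S = top" using * n by (cases ?S) (auto simp flip: ennreal_plus)
    then show ?thesis unfolding ext_expectation_def top n using n(2) by (simp add: enn2ereal_ennreal)
  qed
qed

text \<open>The pair of \<open>\<xi>\<close> and \<open>\<beta>\<close> is measurable for the
  initial algebra and hence independent of \<open>Z\<close>; Tonelli's theorem for the product law
  integrates \<open>Z\<close> out with the pair held fixed.\<close>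

lemma (in prob_space) ext_expectation_freezing:
  fixes \<xi> \<beta> :: "'a \<Rightarrow> real ^ 'd" and Z :: "'a \<Rightarrow> 'z::euclidean_space"
    and c :: "((real ^ 'd) \<times> (real ^ 'd)) \<times> 'z \<Rightarrow> real"
  assumes \<xi>: "\<xi> \<in> borel_measurable M" and Z: "Z \<in> borel_measurable M"
    and indep: "\<And>B C. B \<in> sets borel \<Longrightarrow> C \<in> sets borel \<Longrightarrow>
      prob ((\<xi> -` B \<inter> space M) \<inter> (Z -` C \<inter> space M)) =
      prob (\<xi> -` B \<inter> space M) * prob (Z -` C \<inter> space M)"
    and c: "c \<in> borel_measurable borel" and C: "0 \<le> C" "\<And>y z. - C \<le> c (y, z)"
    and int: "\<And>y. integrable M (\<lambda>\<omega>. c (y, Z \<omega>))"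
    and \<beta>: "\<beta> \<in> borel_measurable (initial_algebra M \<xi>)"
  shows "ext_expectation M (\<lambda>\<omega>. c ((\<xi> \<omega>, \<beta> \<omega>), Z \<omega>)) =
    enn2ereal (\<integral>\<^sup>+\<omega>. ennreal ((\<integral>\<omega>'. c ((\<xi> \<omega>, \<beta> \<omega>), Z \<omega>') \<partial>M) + C) \<partial>M) - ereal C"
proof -
  define T where "T \<omega> = (\<xi> \<omega>, \<beta> \<omega>)" for \<omega>
  have T0: "T \<in> measurable (initial_algebra M \<xi>) borel"
    unfolding T_def using \<beta> by measurable
  note [measurable] = measurable_from_initial_algebra[OF \<xi> T0] Z
  have c' [measurable]: "c \<in> borel_measurable (borel \<Otimes>\<^sub>M borel)" using c by (simp add: borel_prod)
  have "prob_space (distr M borel Z)" using Z by (rule prob_space_distr)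
  then interpret Z: sigma_finite_measure "distr M borel Z" by (rule prob_space_imp_sigma_finite)
  have "(\<integral>\<^sup>+\<omega>. ennreal (c (T \<omega>, Z \<omega>) + C) \<partial>M) =
      (\<integral>\<^sup>+w. ennreal (c w + C) \<partial>distr M (borel \<Otimes>\<^sub>M borel) (\<lambda>\<omega>. (T \<omega>, Z \<omega>)))"
    by (subst nn_integral_distr) auto
  also have "\<dots> = (\<integral>\<^sup>+w. ennreal (c w + C) \<partial>(distr M borel T \<Otimes>\<^sub>M distr M borel Z))"
    by (subst distr_Pair_initial_algebra[OF \<xi> Z T0 indep]) auto
  also have "\<dots> = (\<integral>\<^sup>+y. \<integral>\<^sup>+z. ennreal (c (y, z) + C) \<partial>distr M borel Z \<partial>distr M borel T)"
    by (rule Z.nn_integral_fst[symmetric]) measurable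
  also have "\<dots> = (\<integral>\<^sup>+\<omega>. \<integral>\<^sup>+z. ennreal (c (T \<omega>, z) + C) \<partial>distr M borel Z \<partial>M)"
    by (subst nn_integral_distr) auto
  also have "\<dots> = (\<integral>\<^sup>+\<omega>. \<integral>\<^sup>+\<omega>'. ennreal (c (T \<omega>, Z \<omega>') + C) \<partial>M \<partial>M)"
    by (subst nn_integral_distr) auto
  also have "\<dots> = (\<integral>\<^sup>+\<omega>. ennreal ((\<integral>\<omega>'. c (T \<omega>, Z \<omega>') \<partial>M) + C) \<partial>M)"
  proof (intro nn_integral_cong)
    fix \<omega>
    have "0 \<le> c (y, z) + C" for y z using C(2)[of y z] by linarith
    then
    have "(\<integral>\<^sup>+\<omega>'. ennreal (c (T \<omega>, Z \<omega>') + C) \<partial>M) = ennreal (\<integral>\<omega>'. c (T \<omega>, Z \<omega>') + C \<partial>M)"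
      using int by (intro nn_integral_eq_integral AE_I2) auto
    then show "(\<integral>\<^sup>+\<omega>'. ennreal (c (T \<omega>, Z \<omega>') + C) \<partial>M) =
        ennreal ((\<integral>\<omega>'. c (T \<omega>, Z \<omega>') \<partial>M) + C)"
      using int by (simp add: prob_space)
  qed
  finally have "(\<integral>\<^sup>+\<omega>. ennreal (c (T \<omega>, Z \<omega>) + C) \<partial>M) =
      (\<integral>\<^sup>+\<omega>. ennreal ((\<integral>\<omega>'. c (T \<omega>, Z \<omega>') \<partial>M) + C) \<partial>M)" .
  moreover have "(\<lambda>\<omega>. c (T \<omega>, Z \<omega>)) \<in> borel_measurable M" by measurable
  ultimately show ?thesis
    using ext_expectation_bounded_below[of "\<lambda>\<omega>. c (T \<omega>, Z \<omega>)" C] C by (simp add: T_def)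
qed

text \<open>A Borel selection of strictly better actions would yield a better control, so that the set of
  states where the control is suboptimal is negligible.\<close>

lemma (in prob_space) optimal_control_pointwise:
  fixes \<xi> \<alpha> :: "'a \<Rightarrow> real ^ 'd" and Z :: "'a \<Rightarrow> 'z::euclidean_space"
    and c :: "((real ^ 'd) \<times> (real ^ 'd)) \<times> 'z \<Rightarrow> real"
  assumes \<xi>: "\<xi> \<in> borel_measurable M" and Z: "Z \<in> borel_measurable M"
    and indep: "\<And>B C. B \<in> sets borel \<Longrightarrow> C \<in> sets borel \<Longrightarrow>
      prob ((\<xi> -` B \<inter> space M) \<inter> (Z -` C \<inter> space M)) =
      prob (\<xi> -` B \<inter> space M) * prob (Z -` C \<inter> space M)"
    and c: "c \<in> borel_measurable borel" and C: "0 \<le> C" "\<And>y z. - C \<le> c (y, z)"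
    and int: "\<And>y. integrable M (\<lambda>\<omega>. c (y, Z \<omega>))"
    and A: "A \<in> sets borel" and p: "0 \<le> p"
    and min: "is_arg_min (\<lambda>\<beta>. ext_expectation M (\<lambda>\<omega>. c ((\<xi> \<omega>, \<beta> \<omega>), Z \<omega>)))
        (\<lambda>\<beta>. \<beta> \<in> admissible A p M \<xi>) \<alpha>"
    and fin: "ext_expectation M (\<lambda>\<omega>. c ((\<xi> \<omega>, \<alpha> \<omega>), Z \<omega>)) < \<infinity>"
  shows "AE \<omega> in M. \<forall>a\<in>A. (\<integral>\<omega>'. c ((\<xi> \<omega>, \<alpha> \<omega>), Z \<omega>') \<partial>M) \<le> (\<integral>\<omega>'. c ((\<xi> \<omega>, a), Z \<omega>') \<partial>M)"
proof (rule ccontr)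
  define F where "F y = (\<integral>\<omega>. c (y, Z \<omega>) \<partial>M)" for y
  assume "\<not> ?thesis"
  then have not_opt: "\<not> (AE \<omega> in M. \<forall>a\<in>A. F (\<xi> \<omega>, \<alpha> \<omega>) \<le> F (\<xi> \<omega>, a))" by (simp add: F_def)
  note [measurable] = Z
  have [measurable]: "c \<in> borel_measurable (borel \<Otimes>\<^sub>M borel)" using c by (simp add: borel_prod)
  have F [measurable]: "F \<in> borel_measurable borel"
    unfolding F_def by measurable
  have FC: "0 \<le> F y + C" for y
  proof -
    have "(\<integral>\<omega>. - C \<partial>M) \<le> F y"
      unfolding F_def using int C by (intro integral_mono) auto
    then show ?thesis by (simp add: prob_space)
  qed
  have \<alpha>: "\<alpha> \<in> borel_measurable (initial_algebra M \<xi>)" "\<And>\<omega>. \<omega> \<in> space M \<Longrightarrow> \<alpha> \<omega> \<in> A"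
      "integrable M (\<lambda>\<omega>. norm (\<alpha> \<omega>) powr p)"
    using min unfolding is_arg_min_def admissible_def by auto
  define T where "T \<omega> = (\<xi> \<omega>, \<alpha> \<omega>)" for \<omega>
  have T0 [measurable]: "T \<in> measurable (initial_algebra M \<xi>) borel"
    unfolding T_def using \<alpha>(1) by measurable
  note TM [measurable] = measurable_from_initial_algebra[OF \<xi> T0]
  \<comment> \<open>The base point is the pair of state and current action, so the better action may
    depend on both. The bound \<open>R\<close> keeps the new control
    \<open>p\<close>-integrable.\<close>
  define S where "S R = {w. snd w \<in> A \<and> norm (snd w) \<le> real R \<and>
      F (fst (fst w), snd w) < F (fst w)}" for R
  have S: "S R \<in> sets borel" for R
  proof -
    have [measurable]: "A \<in> sets borel" by fact
    have [measurable]: "F \<in> borel_measurable (borel \<Otimes>\<^sub>M borel)" using F by (simp add: borel_prod)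
    have "S R = {w \<in> space ((borel \<Otimes>\<^sub>M borel) \<Otimes>\<^sub>M borel). snd w \<in> A \<and> norm (snd w) \<le> real R \<and>
      F (fst (fst w), snd w) < F (fst w)}" by (simp add: S_def space_pair_measure)
    also have "\<dots> \<in> sets ((borel \<Otimes>\<^sub>M borel) \<Otimes>\<^sub>M borel)"
      by measurable
    finally show ?thesis unfolding borel_prod .
  qed
  \<comment> \<open>Countably many bounds exhaust the actions, so one of them leaves a
    non-negligible set of improvable pairs.\<close>
  have "\<exists>R. \<not> (AE y in distr M borel T. \<forall>a. (y, a) \<notin> S R)"
  proof (rule ccontr)
    assume "\<not> ?thesis"
    then have "\<And>R. AE \<omega> in M. \<forall>a. (T \<omega>, a) \<notin> S R"
      using AE_distrD[OF TM] by blast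
    then have "AE \<omega> in M. \<forall>R. \<forall>a. (T \<omega>, a) \<notin> S R"
      by (simp add: AE_all_countable)
    then have "AE \<omega> in M. \<forall>a\<in>A. F (\<xi> \<omega>, \<alpha> \<omega>) \<le> F (\<xi> \<omega>, a)"
    proof eventually_elim
      case (elim \<omega>)
      show ?case
      proof
        fix a assume a: "a \<in> A"
        obtain R :: nat where "norm a \<le> real R" using real_arch_simple by blast
        then show "F (\<xi> \<omega>, \<alpha> \<omega>) \<le> F (\<xi> \<omega>, a)"
          using elim[rule_format, of a R] a by (simp add: S_def T_def)
      qed
    qed
    with not_opt show False by simp
  qed
  then obtain R where R: "\<not> (AE y in distr M borel T. \<forall>a. (y, a) \<notin> S R)" by blast
  have "prob_space (distr M borel T)" using TM by (rule prob_space_distr)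
  then have "finite_measure (distr M borel T)" by (simp add: prob_space_def)
  then obtain Q \<psi> where Q [measurable]: "Q \<in> sets borel" and posQ: "emeasure (distr M borel T) Q > 0"
    and \<psi> [measurable]: "\<psi> \<in> borel_measurable borel" and sel: "\<And>y. y \<in> Q \<Longrightarrow> (y, \<psi> y) \<in> S R"
    using borel_selection_on_positive_measure[OF _ _ S R] by auto
  \<comment> \<open>Since \<open>\<psi>\<close> is composed with \<open>T\<close>, the new control
    stays measurable for the initial algebra.\<close>
  define \<beta> where "\<beta> \<omega> = (if T \<omega> \<in> Q then \<psi> (T \<omega>) else \<alpha> \<omega>)" for \<omega>
  have \<beta>0: "\<beta> \<in> borel_measurable (initial_algebra M \<xi>)"
    unfolding \<beta>_def using \<alpha>(1) by measurable
  note \<beta>M = measurable_from_initial_algebra[OF \<xi> \<beta>0]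
  have "\<beta> \<in> admissible A p M \<xi>"
    unfolding admissible_def
  proof (intro CollectI conjI ballI \<beta>0)
    show "\<beta> \<omega> \<in> A" if "\<omega> \<in> space M" for \<omega>
      using sel[of "T \<omega>"] \<alpha>(2)[OF that] by (auto simp: \<beta>_def S_def)
    show "integrable M (\<lambda>\<omega>. norm (\<beta> \<omega>) powr p)"
    proof (rule Bochner_Integration.integrable_bound)
      show "integrable M (\<lambda>\<omega>. norm (\<alpha> \<omega>) powr p + real R powr p)" using \<alpha>(3) by simp
      show "AE \<omega> in M. norm (norm (\<beta> \<omega>) powr p) \<le> norm (norm (\<alpha> \<omega>) powr p + real R powr p)"
      proof (rule AE_I2)
        fix \<omega>
        have "norm (\<beta> \<omega>) powr p \<le> norm (\<alpha> \<omega>) powr p + real R powr p"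
        proof (cases "T \<omega> \<in> Q")
          case True
          then have "norm (\<beta> \<omega>) powr p \<le> real R powr p"
            using sel[of "T \<omega>"] p by (auto simp: \<beta>_def S_def intro!: powr_mono2)
          then show ?thesis by (simp add: add_increasing)
        qed (simp add: \<beta>_def)
        then show "norm (norm (\<beta> \<omega>) powr p) \<le> norm (norm (\<alpha> \<omega>) powr p + real R powr p)" by simp
      qed
    qed (use \<beta>M in measurable)
  qed
  moreover have "ext_expectation M (\<lambda>\<omega>. c ((\<xi> \<omega>, \<beta> \<omega>), Z \<omega>)) <
      ext_expectation M (\<lambda>\<omega>. c ((\<xi> \<omega>, \<alpha> \<omega>), Z \<omega>))"
  proof -
    have F\<beta>: "F (\<xi> \<omega>, \<beta> \<omega>) \<le> F (\<xi> \<omega>, \<alpha> \<omega>)" "T \<omega> \<in> Q \<Longrightarrow> F (\<xi> \<omega>, \<beta> \<omega>) < F (\<xi> \<omega>, \<alpha> \<omega>)" for \<omega>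
      using sel[of "T \<omega>"] by (auto simp: \<beta>_def S_def T_def less_imp_le)
    let ?I = "\<lambda>\<beta>. \<integral>\<^sup>+\<omega>. ennreal (F (\<xi> \<omega>, \<beta> \<omega>) + C) \<partial>M"
    have J: "ext_expectation M (\<lambda>\<omega>. c ((\<xi> \<omega>, \<gamma> \<omega>), Z \<omega>)) = enn2ereal (?I \<gamma>) - ereal C"
      if "\<gamma> \<in> borel_measurable (initial_algebra M \<xi>)" for \<gamma>
      unfolding F_def using \<xi> Z indep c C int that by (rule ext_expectation_freezing)
    have le: "?I \<beta> \<le> ?I \<alpha>" using F\<beta> by (intro nn_integral_mono ennreal_leI) auto
    \<comment> \<open>Finiteness is what turns the strict pointwise gain on \<open>Q\<close> into a
      strict gain of the integral.\<close>
    have fin\<alpha>: "?I \<alpha> \<noteq> \<infinity>"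
      using fin unfolding J[OF \<alpha>(1)] by auto
    have "?I \<beta> < ?I \<alpha>"
    proof (rule nn_integral_less)
      have "(\<lambda>\<omega>. (\<xi> \<omega>, \<beta> \<omega>)) \<in> borel_measurable M" using \<xi> \<beta>M by measurable
      then show "(\<lambda>\<omega>. ennreal (F (\<xi> \<omega>, \<beta> \<omega>) + C)) \<in> borel_measurable M"
        using measurable_compose[OF _ F] by measurable
      show "(\<lambda>\<omega>. ennreal (F (\<xi> \<omega>, \<alpha> \<omega>) + C)) \<in> borel_measurable M"
        using measurable_compose[OF TM F] unfolding T_def by measurable
      show "?I \<beta> \<noteq> \<infinity>" using le fin\<alpha> by (auto simp: top_unique)
      show "AE \<omega> in M. ennreal (F (\<xi> \<omega>, \<beta> \<omega>) + C) \<le> ennreal (F (\<xi> \<omega>, \<alpha> \<omega>) + C)"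
        using F\<beta> by (intro AE_I2 ennreal_leI) auto
      show "\<not> (AE \<omega> in M. ennreal (F (\<xi> \<omega>, \<alpha> \<omega>) + C) \<le> ennreal (F (\<xi> \<omega>, \<beta> \<omega>) + C))"
      proof
        assume "AE \<omega> in M. ennreal (F (\<xi> \<omega>, \<alpha> \<omega>) + C) \<le> ennreal (F (\<xi> \<omega>, \<beta> \<omega>) + C)"
        then have "AE \<omega> in M. T \<omega> \<notin> Q"
        proof eventually_elim
          case (elim \<omega>)
          then have "F (\<xi> \<omega>, \<alpha> \<omega>) \<le> F (\<xi> \<omega>, \<beta> \<omega>)"
            using FC by (simp add: ennreal_le_iff)
          then show ?case using F\<beta>(2)[of \<omega>] by linarith
        qed
        then have "emeasure M {\<omega> \<in> space M. T \<omega> \<in> Q} = 0"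
          by (subst (asm) AE_iff_measurable[OF _ refl]) auto
        moreover have "T -` Q \<inter> space M = {\<omega> \<in> space M. T \<omega> \<in> Q}" by auto
        ultimately show False using posQ by (simp add: emeasure_distr)
      qed
    qed
    then have "enn2ereal (?I \<beta>) < enn2ereal (?I \<alpha>)" by (simp add: less_ennreal.rep_eq)
    then show ?thesis unfolding J[OF \<alpha>(1)] J[OF \<beta>0]
      by (cases "enn2ereal (?I \<beta>)"; cases "enn2ereal (?I \<alpha>)") auto
  qed
  ultimately show False using min unfolding is_arg_min_def by blast
qed

section \<open>Moment bounds, integrability and continuity for a fixed law\<close>

lemma norm_add_powr_le:
  fixes u v :: "'v::real_normed_vector"
  assumes "0 \<le> r"
  shows "norm (u + v) powr r \<le> 2 powr r * (norm u powr r + norm v powr r)"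
proof -
  define m where "m = max (norm u) (norm v)"
  have "norm (u + v) \<le> 2 * m" using norm_triangle_ineq[of u v] by (simp add: m_def)
  then have "norm (u + v) powr r \<le> (2 * m) powr r" using assms by (intro powr_mono2) auto
  also have "\<dots> = 2 powr r * m powr r" by (simp add: powr_mult m_def)
  also have "\<dots> \<le> 2 powr r * (norm u powr r + norm v powr r)"
    by (intro mult_left_mono) (auto simp: m_def max_def)
  finally show ?thesis .
qed

lemma powr_le_one_add_powr:
  fixes x :: real
  assumes "0 \<le> x" "0 \<le> q" "q \<le> p"
  shows "x powr q \<le> 1 + x powr p"
proof (cases "x \<le> 1")
  case True
  then have "x powr q \<le> 1 powr q" using assms by (intro powr_mono2) auto
  then show ?thesis by (simp add: add_increasing2)
next
  case False
  then have "x powr q \<le> x powr p" using assms by (intro powr_mono) auto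
  then show ?thesis by simp
qed

lemma integrable_norm_add_powr:
  fixes f g :: "'a \<Rightarrow> 'v::{second_countable_topology, real_normed_vector}"
  assumes "0 \<le> r" and [measurable]: "f \<in> borel_measurable M" "g \<in> borel_measurable M"
    and "integrable M (\<lambda>x. norm (f x) powr r)" "integrable M (\<lambda>x. norm (g x) powr r)"
  shows "integrable M (\<lambda>x. norm (f x + g x) powr r)"
proof (rule Bochner_Integration.integrable_bound)
  show "integrable M (\<lambda>x. 2 powr r * (norm (f x) powr r + norm (g x) powr r))"
    using assms by simp
  show "AE x in M. norm (norm (f x + g x) powr r) \<le> norm (2 powr r * (norm (f x) powr r + norm (g x) powr r))"
    using norm_add_powr_le[OF assms(1)] by (intro AE_I2) simp
qed measurable

lemma (in finite_measure) integrable_norm_powr_mono: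
  fixes f :: "'a \<Rightarrow> 'v::{second_countable_topology, real_normed_vector}"
  assumes [measurable]: "f \<in> borel_measurable M"
    and "integrable M (\<lambda>x. norm (f x) powr p)" "0 \<le> q" "q \<le> p"
  shows "integrable M (\<lambda>x. norm (f x) powr q)"
proof (rule Bochner_Integration.integrable_bound)
  show "integrable M (\<lambda>x. 1 + norm (f x) powr p)"
    using assms by simp
  show "AE x in M. norm (norm (f x) powr q) \<le> norm (1 + norm (f x) powr p)"
    using powr_le_one_add_powr[of "norm (f _)" q p] assms(3,4) by (intro AE_I2) simp
qed measurable

text \<open>The law is inserted by a constant map into the Wasserstein space, which is continuous
  because its value lies in \<open>S\<close>.\<close>

lemma continuous_on_fixed_measure:
  fixes f :: "real ^ 'd \<Rightarrow> real ^ 'd \<Rightarrow> (real ^ 'd) measure \<Rightarrow> 'v::topological_space"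
  assumes f: "continuous_map (prod_topology euclidean (prod_topology (top_of_set A) (W1_topology S)))
      euclidean (\<lambda>(x, a, \<nu>). f x a \<nu>)"
    and \<mu>: "\<mu> \<in> S"
  shows "continuous_on (UNIV \<times> A) (\<lambda>(x, a). f x a \<mu>)"
proof -
  have "continuous_map (top_of_set (UNIV \<times> A)) euclidean fst"
    by (auto simp: continuous_map_iff_continuous intro: continuous_intros)
  moreover have "continuous_map (top_of_set (UNIV \<times> A)) (top_of_set A) snd"
    by (auto simp: continuous_map_in_subtopology intro: continuous_intros)
  moreover have "continuous_map (top_of_set (UNIV \<times> A)) (W1_topology S) (\<lambda>w. \<mu>)"
    using \<mu> by (simp add: topspace_W1_topology)
  ultimately have "continuous_map (top_of_set (UNIV \<times> A))
      (prod_topology euclidean (prod_topology (top_of_set A) (W1_topology S))) (\<lambda>w. (fst w, snd w, \<mu>))"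
    by (intro continuous_map_pairedI)
  from continuous_map_compose[OF this f] show ?thesis
    by (simp add: o_def case_prod_beta continuous_map_iff_continuous)
qed

lemma ext_expectation_cong:
  assumes "\<And>\<omega>. \<omega> \<in> space M \<Longrightarrow> f \<omega> = g \<omega>"
  shows "ext_expectation M f = ext_expectation M g"
  unfolding ext_expectation_def using assms by (simp cong: nn_integral_cong)

lemma ext_expectation_integrable:
  assumes "integrable M f"
  shows "ext_expectation M f = ereal (\<integral>\<omega>. f \<omega> \<partial>M)"
proof -
  obtain r s where rs: "0 \<le> r" "0 \<le> s" "(\<integral>\<^sup>+\<omega>. ennreal (f \<omega>) \<partial>M) = ennreal r"
      "(\<integral>\<^sup>+\<omega>. ennreal (- f \<omega>) \<partial>M) = ennreal s" "(\<integral>\<omega>. f \<omega> \<partial>M) = r - s"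
    using assms by (rule integrableE)
  then show ?thesis by (simp add: ext_expectation_def enn2ereal_ennreal)
qed

lemma is_arg_min_cong:
  assumes "\<And>y. P y \<Longrightarrow> f y = g y"
  shows "is_arg_min f P x \<longleftrightarrow> is_arg_min g P x"
  using assms unfolding is_arg_min_def by metis

section \<open>Uniqueness of the equilibrium\<close>

theorem proposition2p6:
  fixes p q \<delta> C_b C_G C_L c_L K :: real
    and A :: "(real ^ 'd) set"
    and M :: "'w measure"
    and \<xi> Z :: "'w \<Rightarrow> real ^ 'd"
    and U :: "'w \<Rightarrow> real"
    and b :: "real ^ 'd \<Rightarrow> real ^ 'd \<Rightarrow> (real ^ 'd) measure \<Rightarrow> real ^ 'd"
    and L :: "real ^ 'd \<Rightarrow> real ^ 'd \<Rightarrow> (real ^ 'd) measure \<Rightarrow> real"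
    and G :: "real ^ 'd \<Rightarrow> (real ^ 'd) measure \<Rightarrow> real"
  assumes "1 < p" and "1 \<le> q" and "q \<le> p" and "0 < \<delta>"
    and "closed A" and "convex A" and "0 \<in> A"
    \<comment> \<open>the probability space and the random variables\<close>
    and "prob_space M" and "complete_measure M"
    and "\<xi> \<in> borel_measurable M" and "integrable M (\<lambda>\<omega>. norm (\<xi> \<omega>) powr p)"
    and "Z \<in> borel_measurable M" and "integrable M (\<lambda>\<omega>. norm (Z \<omega>) powr p)"
    and "U \<in> borel_measurable M" and "distr M borel U = uniform_measure lborel {0..1}"
    and "prob_space.indep_sets M
           (\<lambda>i. [{\<xi> -` B \<inter> space M | B. B \<in> sets borel},
                 {Z -` B \<inter> space M | B. B \<in> sets borel},
                 {U -` B \<inter> space M | B. B \<in> sets borel}] ! i) {0, 1, 2}"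
    \<comment> \<open>constants\<close>
    and "1 \<le> C_b" and "0 \<le> C_G" and "0 \<le> C_L" and "0 < c_L"
    and "K = mfg_K p q \<delta> C_b C_G C_L c_L M \<xi> Z"
    \<comment> \<open>(i)\<close>
    and "continuous_map
           (prod_topology euclidean (prod_topology (top_of_set A) (W1_topology (prob_moment_le p K))))
           euclidean (\<lambda>(x, a, \<mu>). b x a \<mu>)"
    and "\<And>x a \<mu>. a \<in> A \<Longrightarrow> \<mu> \<in> prob_moment p \<Longrightarrow>
           norm (b x a \<mu>) \<le> C_b * (1 + norm x + norm a + moment_norm 1 \<mu>)"
    \<comment> \<open>(ii)\<close>
    and "continuous_map
           (prod_topology euclidean (prod_topology (top_of_set A) (W1_topology (prob_moment_le p K))))
           euclidean (\<lambda>(x, a, \<mu>). L x a \<mu>)"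
    and "continuous_map (prod_topology euclidean (W1_topology (prob_moment_le p K)))
           euclidean (\<lambda>(x, \<mu>). G x \<mu>)"
    and "\<And>x \<mu>. \<mu> \<in> prob_moment p \<Longrightarrow> - C_G \<le> G x \<mu> \<and> G x \<mu> \<le> C_G * (1 + norm x powr q)"
    and "\<And>x a \<mu>. a \<in> A \<Longrightarrow> \<mu> \<in> prob_moment p \<Longrightarrow> c_L * (norm a powr p - 1) \<le> L x a \<mu>"
    and "\<And>x \<mu>. \<mu> \<in> prob_moment p \<Longrightarrow>
           L x 0 \<mu> \<le> C_L * (1 + norm x powr q + moment_norm q \<mu> powr q)"
    \<comment> \<open>well-posedness of the integrals of \<open>G\<close> in (iii), the cost and the monotonicity condition\<close>
    and "\<And>m. m \<in> prob_moment p \<Longrightarrow> (\<lambda>x. G x m) \<in> borel_measurable borel"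
    \<comment> \<open>(iii)\<close>
    and "\<And>x m \<mu>. m \<in> prob_moment p \<Longrightarrow> \<mu> \<in> prob_moment p \<Longrightarrow>
           \<exists>!a. is_arg_min
             (\<lambda>a. L x a \<mu> * \<delta> + (\<integral>\<omega>. G (x + \<delta> *\<^sub>R b x a \<mu> + Z \<omega>) m \<partial>M)) (\<lambda>a. a \<in> A) a"
    and "lasry_lions_monotone p G"
  shows "\<forall>\<alpha>1 m1 \<alpha>2 m2.
           mean_field_equilibrium A p \<delta> M \<xi> Z b L G \<alpha>1 m1 \<and>
           mean_field_equilibrium A p \<delta> M \<xi> Z b L G \<alpha>2 m2 \<longrightarrow>
           (AE \<omega> in M. \<alpha>1 \<omega> = \<alpha>2 \<omega>) \<and> m1 = m2"
proof (intro allI impI)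

  \<comment> \<open>Game data with the initial law frozen\<close>
  interpret prob_space M by (rule assms(8))
  note p = assms(1) and q = assms(2,3) and \<delta> = assms(4) and Zm = assms(12) and \<xi>m = assms(10)
  note [measurable] = \<xi>m Zm
  have A [measurable]: "A \<in> sets borel" using assms(5) by (rule borel_closed)
  have indep: "prob ((\<xi> -` B \<inter> space M) \<inter> (Z -` C \<inter> space M)) =
      prob (\<xi> -` B \<inter> space M) * prob (Z -` C \<inter> space M)"
    if "B \<in> sets borel" "C \<in> sets borel" for B C
  proof -
    \<comment> \<open>Indices 0 and 1 pick the events of \<open>\<xi>\<close> and of
      \<open>Z\<close> from the independent family.\<close>
    let ?F = "\<lambda>i :: nat. if i = 0 then \<xi> -` B \<inter> space M else Z -` C \<inter> space M"
    have "prob (\<Inter>j\<in>{0, 1}. ?F j) = (\<Prod>j\<in>{0, 1}. prob (?F j))"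
      by (rule indep_setsD[OF assms(16)]) (use that in auto)
    then show ?thesis by (simp add: Int_commute)
  qed
  define \<mu> where "\<mu> = distr M borel \<xi>"
  have \<mu>: "\<mu> \<in> prob_moment p"
    using assms(11) by (auto simp: prob_moment_def \<mu>_def integrable_distr_eq intro!: prob_space_distr)
  \<comment> \<open>Continuity of \<open>b\<close> and \<open>L\<close> is given only at laws in
    \<open>prob_moment_le p K\<close>. The initial law is one of them: its moment is a summand in
    \<open>K\<close>, the other summands are nonnegative, and the factor \<open>4 powr p\<close> is
    at least 1.\<close>
  have \<mu>K: "\<mu> \<in> prob_moment_le p K"
  proof -
    let ?E = "\<integral>\<omega>. norm (\<xi> \<omega>) powr p \<partial>M"
    let ?R = "2 + ?E + 1 / (c_L * \<delta>) * (mfg_C_J q C_b C_L M \<xi> Z + C_G) + (\<integral>\<omega>. norm (Z \<omega>) powr p \<partial>M)"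
    have "0 \<le> mfg_C_J q C_b C_L M \<xi> Z"
      using assms(19) unfolding mfg_C_J_def by (intro mult_nonneg_nonneg add_nonneg_nonneg) auto
    then have "0 \<le> 1 / (c_L * \<delta>) * (mfg_C_J q C_b C_L M \<xi> Z + C_G)"
      using assms(18,20) \<delta> by simp
    moreover have "0 \<le> (\<integral>\<omega>. norm (Z \<omega>) powr p \<partial>M)" "0 \<le> ?E" by simp_all
    ultimately have "?E \<le> ?R" "0 \<le> ?R" by linarith+
    moreover have "(1 :: real) \<le> 4 powr p" using p by (intro ge_one_powr_ge_zero) auto
    moreover have "e \<le> k * r" if "e \<le> r" "0 \<le> r" "1 \<le> k" for e r k :: real
      using mult_right_mono[OF that(3,2)] that(1) by simp
    ultimately have "?E \<le> 4 powr p * ?R" by blast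
    also have "\<dots> = K" by (simp only: assms(21) mfg_K_def)
    finally have "?E \<le> K" .
    then show ?thesis using \<mu> by (simp add: prob_moment_le_def \<mu>_def integral_distr)
  qed
  \<comment> \<open>Extension by 0 off the closed set \<open>A\<close> yields functions that are
    Borel on the whole space. Admissible controls take values in \<open>A\<close>, so their costs
    are unchanged.\<close>
  define b' where "b' w = (if w \<in> UNIV \<times> A then b (fst w) (snd w) \<mu> else 0)" for w
  define L' where "L' w = (if w \<in> UNIV \<times> A then L (fst w) (snd w) \<mu> else 0)" for w
  have UA: "UNIV \<times> A \<in> sets (borel :: ((real ^ 'd) \<times> (real ^ 'd)) measure)"
    using assms(5) by (intro borel_closed closed_Times) auto
  have "b' \<in> borel_measurable borel"
    unfolding b'_def using continuous_on_fixed_measure[OF assms(22) \<mu>K]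
    by (intro borel_measurable_continuous_on_if UA) (auto simp: case_prod_beta)
  then have b'm [measurable]: "b' \<in> borel_measurable (borel \<Otimes>\<^sub>M borel)" by (simp add: borel_prod)
  have "L' \<in> borel_measurable borel"
    unfolding L'_def using continuous_on_fixed_measure[OF assms(24) \<mu>K]
    by (intro borel_measurable_continuous_on_if UA) (auto simp: case_prod_beta)
  then have L'm [measurable]: "L' \<in> borel_measurable (borel \<Otimes>\<^sub>M borel)" by (simp add: borel_prod)
  define c where "c m w = L' (fst w) * \<delta> + G (fst (fst w) + \<delta> *\<^sub>R b' (fst w) + snd w) m" for m w
  \<comment> \<open>The term \<open>c_L * \<delta>\<close> bounds the negative part of the running
    cost, by the coercivity in (ii) with the power of the action dropped, and \<open>C_G\<close>
    bounds that of \<open>G\<close>.\<close>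
  define C where "C = c_L * \<delta> + C_G"
  have C0: "0 \<le> C" using assms(18,20) \<delta> by (simp add: C_def)
  have L'_lower: "- c_L \<le> L' w" for w
  proof (cases "snd w \<in> A")
    case True
    have "- c_L \<le> c_L * (norm (snd w) powr p - 1)" using assms(20) by (simp add: algebra_simps)
    also have "\<dots> \<le> L' w" using assms(27)[OF True \<mu>, of "fst w"] True by (cases w) (simp add: L'_def)
    finally show ?thesis .
  qed (use assms(20) in \<open>cases w, simp add: L'_def\<close>)
  have cC: "- C \<le> c m (y, z)" if "m \<in> prob_moment p" for m y z
  proof -
    have "- c_L * \<delta> \<le> L' y * \<delta>" using L'_lower[of y] \<delta> by (intro mult_right_mono) auto
    then show ?thesis using assms(26)[OF that, of "fst y + \<delta> *\<^sub>R b' y + z"] by (simp add: c_def C_def)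
  qed
  have cm: "c m \<in> borel_measurable borel" if "m \<in> prob_moment p" for m
  proof -
    have [measurable]: "(\<lambda>x. G x m) \<in> borel_measurable borel" using assms(29)[OF that] .
    have "c m \<in> borel_measurable ((borel \<Otimes>\<^sub>M borel) \<Otimes>\<^sub>M borel)"
      unfolding c_def by measurable
    then show ?thesis unfolding borel_prod .
  qed

  \<comment> \<open>Integrability and finite costs\<close>
  have G_int: "integrable M (\<lambda>\<omega>. G (X \<omega>) m)"
    if m: "m \<in> prob_moment p" and X [measurable]: "X \<in> borel_measurable M"
      and Xp: "integrable M (\<lambda>\<omega>. norm (X \<omega>) powr p)" for X m
  proof (rule Bochner_Integration.integrable_bound)
    have "integrable M (\<lambda>\<omega>. norm (X \<omega>) powr q)"
      using integrable_norm_powr_mono[OF X Xp] q by simp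
    then show "integrable M (\<lambda>\<omega>. C_G * (1 + norm (X \<omega>) powr q))" by simp
    show "AE \<omega> in M. norm (G (X \<omega>) m) \<le> norm (C_G * (1 + norm (X \<omega>) powr q))"
    proof (intro AE_I2)
      fix \<omega>
      have "C_G * 1 \<le> C_G * (1 + norm (X \<omega>) powr q)" using assms(18) by (intro mult_left_mono) auto
      then show "norm (G (X \<omega>) m) \<le> norm (C_G * (1 + norm (X \<omega>) powr q))"
        using assms(26)[OF m, of "X \<omega>"] unfolding real_norm_def mult_1_right by linarith
    qed
    show "(\<lambda>\<omega>. G (X \<omega>) m) \<in> borel_measurable M"
      using measurable_compose[OF X assms(29)[OF m]] .
  qed
  have p0: "0 \<le> p" using p by simp
  have GZ_int: "integrable M (\<lambda>\<omega>. G (y + Z \<omega>) m)" if m: "m \<in> prob_moment p" for m y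
    by (rule G_int[OF m]) (auto intro!: integrable_norm_add_powr p0 assms(13))
  have c_int: "integrable M (\<lambda>\<omega>. c m (y, Z \<omega>))" if m: "m \<in> prob_moment p" for m y
    using GZ_int[OF m] by (simp add: c_def)
  have cost: "mfg_cost \<delta> M \<xi> Z b L G m \<beta> = ext_expectation M (\<lambda>\<omega>. c m ((\<xi> \<omega>, \<beta> \<omega>), Z \<omega>))"
    if "\<beta> \<in> admissible A p M \<xi>" for m \<beta>
    unfolding mfg_cost_def controlled_state_def \<mu>_def[symmetric]
    using that by (intro ext_expectation_cong) (simp add: c_def L'_def b'_def admissible_def)
  have state_m: "controlled_state \<delta> M \<xi> Z b \<beta> \<in> borel_measurable M"
    if "\<beta> \<in> admissible A p M \<xi>" for \<beta>
  proof -
    have [measurable]: "\<beta> \<in> borel_measurable M"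
      using that by (auto simp: admissible_def intro: measurable_from_initial_algebra[OF \<xi>m])
    have "(\<lambda>\<omega>. \<xi> \<omega> + \<delta> *\<^sub>R b' (\<xi> \<omega>, \<beta> \<omega>) + Z \<omega>) \<in> borel_measurable M" by measurable
    then show ?thesis
      using that by (subst measurable_cong)
        (auto simp: controlled_state_def b'_def admissible_def \<mu>_def[symmetric])
  qed
  have zero: "(\<lambda>\<omega>. 0) \<in> admissible A p M \<xi>" using assms(7) by (simp add: admissible_def)
  \<comment> \<open>The zero control is the competitor that makes minimal costs finite: its drift
    grows linearly in the initial state by (i), and its running cost with order \<open>q\<close> by
    (ii).\<close>
  have zero_fin: "ext_expectation M (\<lambda>\<omega>. c m ((\<xi> \<omega>, 0), Z \<omega>)) < \<infinity>" if m: "m \<in> prob_moment p" for m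
  proof -
    have "integrable M (\<lambda>\<omega>. L' (\<xi> \<omega>, 0))"
    proof (rule Bochner_Integration.integrable_bound)
      let ?k = "moment_norm q \<mu> powr q"
      have "integrable M (\<lambda>\<omega>. norm (\<xi> \<omega>) powr q)"
        using integrable_norm_powr_mono[OF \<xi>m assms(11)] q by simp
      then show "integrable M (\<lambda>\<omega>. c_L + C_L * (1 + norm (\<xi> \<omega>) powr q + ?k))" by simp
      show "AE \<omega> in M. norm (L' (\<xi> \<omega>, 0)) \<le> norm (c_L + C_L * (1 + norm (\<xi> \<omega>) powr q + ?k))"
      proof (intro AE_I2)
        fix \<omega>
        have "L' (\<xi> \<omega>, 0) \<le> C_L * (1 + norm (\<xi> \<omega>) powr q + ?k)"
          using assms(28)[OF \<mu>, of "\<xi> \<omega>"] assms(7) by (simp add: L'_def)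
        moreover have "0 \<le> C_L * (1 + norm (\<xi> \<omega>) powr q + ?k)"
          using assms(19) by simp
        ultimately show "norm (L' (\<xi> \<omega>, 0)) \<le> norm (c_L + C_L * (1 + norm (\<xi> \<omega>) powr q + ?k))"
          using L'_lower[of "(\<xi> \<omega>, 0)"] assms(20) unfolding real_norm_def by linarith
      qed
    qed measurable
    moreover have "integrable M (\<lambda>\<omega>. G (\<xi> \<omega> + \<delta> *\<^sub>R b' (\<xi> \<omega>, 0) + Z \<omega>) m)"
    proof (intro G_int[OF m] integrable_norm_add_powr p0 assms(11,13))
      \<comment> \<open>\<open>k\<close> gathers the terms of the growth bound for the drift that do
        not depend on the initial state.\<close>
      define k where "k = \<delta> * C_b * (1 + moment_norm 1 \<mu>)"
      have k0: "0 \<le> k" using \<delta> assms(17) by (simp add: k_def moment_norm_def)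
      show "integrable M (\<lambda>\<omega>. norm (\<delta> *\<^sub>R b' (\<xi> \<omega>, 0)) powr p)"
      proof (rule Bochner_Integration.integrable_bound)
        have "integrable M (\<lambda>\<omega>. norm (\<delta> * C_b * norm (\<xi> \<omega>)) powr p)"
          using assms(11,17) \<delta> by (simp add: abs_mult powr_mult)
        then show "integrable M (\<lambda>\<omega>. norm (k + \<delta> * C_b * norm (\<xi> \<omega>)) powr p)"
          by (intro integrable_norm_add_powr p0) auto
        show "AE \<omega> in M. norm (norm (\<delta> *\<^sub>R b' (\<xi> \<omega>, 0)) powr p)
            \<le> norm (norm (k + \<delta> * C_b * norm (\<xi> \<omega>)) powr p)"
        proof (intro AE_I2)
          fix \<omega>
          have "\<delta> * norm (b' (\<xi> \<omega>, 0)) \<le> \<delta> * (C_b * (1 + norm (\<xi> \<omega>) + moment_norm 1 \<mu>))"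
            using assms(23)[OF assms(7) \<mu>, of "\<xi> \<omega>"] assms(7) \<delta>
            by (intro mult_left_mono) (auto simp: b'_def)
          also have "\<dots> = k + \<delta> * C_b * norm (\<xi> \<omega>)" by (simp add: k_def algebra_simps)
          finally have "norm (\<delta> *\<^sub>R b' (\<xi> \<omega>, 0)) \<le> norm (k + \<delta> * C_b * norm (\<xi> \<omega>))"
            using \<delta> by simp
          then show "norm (norm (\<delta> *\<^sub>R b' (\<xi> \<omega>, 0)) powr p)
            \<le> norm (norm (k + \<delta> * C_b * norm (\<xi> \<omega>)) powr p)"
            using p0 by (simp add: powr_mono2)
        qed
      qed measurable
    qed measurable
    ultimately have "integrable M (\<lambda>\<omega>. c m ((\<xi> \<omega>, 0), Z \<omega>))" by (simp add: c_def)
    then show ?thesis by (simp add: ext_expectation_integrable)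
  qed

  \<comment> \<open>Pointwise optimality and uniqueness of the best response\<close>
  define F where "F m w = (\<integral>\<omega>. c m (w, Z \<omega>) \<partial>M)" for m w
  have optimal: "AE \<omega> in M. is_arg_min (\<lambda>a. F m (\<xi> \<omega>, a)) (\<lambda>a. a \<in> A) (\<alpha> \<omega>)"
    if m: "m \<in> prob_moment p" and min: "is_arg_min (mfg_cost \<delta> M \<xi> Z b L G m) (\<lambda>\<beta>. \<beta> \<in> admissible A p M \<xi>) \<alpha>"
    for m \<alpha>
  proof -
    have min': "is_arg_min (\<lambda>\<beta>. ext_expectation M (\<lambda>\<omega>. c m ((\<xi> \<omega>, \<beta> \<omega>), Z \<omega>)))
        (\<lambda>\<beta>. \<beta> \<in> admissible A p M \<xi>) \<alpha>"
      using min by (rule is_arg_min_cong[THEN iffD1, rotated]) (rule cost)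
    then have "ext_expectation M (\<lambda>\<omega>. c m ((\<xi> \<omega>, \<alpha> \<omega>), Z \<omega>)) < \<infinity>"
      using zero zero_fin[OF m] by (auto simp: is_arg_min_def not_less intro: order_le_less_trans)
    with min' have "AE \<omega> in M. \<forall>a\<in>A. F m (\<xi> \<omega>, \<alpha> \<omega>) \<le> F m (\<xi> \<omega>, a)"
      unfolding F_def by (intro optimal_control_pointwise[OF \<xi>m Zm indep cm[OF m] C0 cC[OF m] c_int[OF m] A p0])
    moreover have "AE \<omega> in M. \<alpha> \<omega> \<in> A"
      using min by (intro AE_I2) (simp add: is_arg_min_def admissible_def)
    ultimately show ?thesis by eventually_elim (auto simp: is_arg_min_def not_less)
  qed
  have unique: "a1 = a2"
    if m: "m \<in> prob_moment p" and a: "is_arg_min (\<lambda>a. F m (x, a)) (\<lambda>a. a \<in> A) a1"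
      "is_arg_min (\<lambda>a. F m (x, a)) (\<lambda>a. a \<in> A) a2" for m x a1 a2
  proof -
    \<comment> \<open>For actions in \<open>A\<close> the running cost comes out of the expectation,
      which leaves the function minimized in (iii).\<close>
    have "F m (x, a) = L x a \<mu> * \<delta> + (\<integral>\<omega>. G (x + \<delta> *\<^sub>R b x a \<mu> + Z \<omega>) m \<partial>M)" if "a \<in> A" for a
      using GZ_int[OF m] that by (simp add: F_def c_def L'_def b'_def prob_space)
    then have "is_arg_min (\<lambda>a. F m (x, a)) (\<lambda>a. a \<in> A) a \<longleftrightarrow> is_arg_min
        (\<lambda>a. L x a \<mu> * \<delta> + (\<integral>\<omega>. G (x + \<delta> *\<^sub>R b x a \<mu> + Z \<omega>) m \<partial>M)) (\<lambda>a. a \<in> A) a" for a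
      by (intro is_arg_min_cong)
    then show ?thesis using a assms(30)[OF m \<mu>, of x] by blast
  qed

  \<comment> \<open>Comparison of two equilibria\<close>
  fix \<alpha>1 m1 \<alpha>2 m2
  let ?mfe = "mean_field_equilibrium A p \<delta> M \<xi> Z b L G"
  let ?X = "controlled_state \<delta> M \<xi> Z b"
  assume "?mfe \<alpha>1 m1 \<and> ?mfe \<alpha>2 m2"
  then have mfe: "?mfe \<alpha>1 m1" "?mfe \<alpha>2 m2" by auto
  have m: "m \<in> prob_moment p"
    and min: "is_arg_min (mfg_cost \<delta> M \<xi> Z b L G m) (\<lambda>\<beta>. \<beta> \<in> admissible A p M \<xi>) \<alpha>"
    and adm: "\<alpha> \<in> admissible A p M \<xi>"
    and law: "distr M borel (?X \<alpha>) = m" if "?mfe \<alpha> m" for \<alpha> m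
    using that unfolding mean_field_equilibrium_def is_arg_min_def by auto
  \<comment> \<open>The law of an equilibrium state is \<open>m\<close>, so the state has a finite
    \<open>p\<close>-th moment. Hence its terminal cost is integrable against every
    \<open>m'\<close>, as needed for the cross terms.\<close>
  have GX_int: "integrable M (\<lambda>\<omega>. G (?X \<alpha> \<omega>) m')" if \<alpha>: "?mfe \<alpha> m" and "m' \<in> prob_moment p" for \<alpha> m m'
  proof (rule G_int[OF that(2) state_m[OF adm[OF \<alpha>]]])
    have "integrable (distr M borel (?X \<alpha>)) (\<lambda>x. norm x powr p)"
      using m[OF \<alpha>] law[OF \<alpha>] by (simp add: prob_moment_def)
    then show "integrable M (\<lambda>\<omega>. norm (?X \<alpha> \<omega>) powr p)"
      using state_m[OF adm[OF \<alpha>]] by (subst (asm) integrable_distr_eq) auto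
  qed
  have c_eq: "c m' ((\<xi> \<omega>, \<alpha> \<omega>), Z \<omega>) = L' (\<xi> \<omega>, \<alpha> \<omega>) * \<delta> + G (?X \<alpha> \<omega>) m'"
    if \<alpha>: "?mfe \<alpha> m" and "\<omega> \<in> space M" for \<alpha> m m' \<omega>
    using adm[OF \<alpha>] that(2)
    by (simp add: c_def b'_def controlled_state_def admissible_def \<mu>_def[symmetric])
  \<comment> \<open>A finite cost together with the lower bound makes the total cost integrable;
    removing the integrable terminal part leaves the running part.\<close>
  have L_int: "integrable M (\<lambda>\<omega>. L' (\<xi> \<omega>, \<alpha> \<omega>) * \<delta>)" if \<alpha>: "?mfe \<alpha> m" for \<alpha> m
  proof -
    have [measurable]: "\<alpha> \<in> borel_measurable M"
      using adm[OF \<alpha>] by (auto simp: admissible_def intro: measurable_from_initial_algebra[OF \<xi>m])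
    let ?c = "\<lambda>\<omega>. c m ((\<xi> \<omega>, \<alpha> \<omega>), Z \<omega>)"
    have "c m \<in> borel_measurable ((borel \<Otimes>\<^sub>M borel) \<Otimes>\<^sub>M borel)"
      using cm[OF m[OF \<alpha>]] by (simp only: borel_prod)
    then have [measurable]: "?c \<in> borel_measurable M" by measurable
    have "ext_expectation M ?c < \<infinity>"
    proof -
      have "mfg_cost \<delta> M \<xi> Z b L G m \<alpha> \<le> mfg_cost \<delta> M \<xi> Z b L G m (\<lambda>\<omega>. 0)"
        using min[OF \<alpha>] zero by (auto simp: is_arg_min_def not_less)
      also have "\<dots> < \<infinity>" using zero_fin[OF m[OF \<alpha>]] by (simp only: cost[OF zero])
      finally show ?thesis by (simp only: cost[OF adm[OF \<alpha>]])
    qed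
    then have "(\<integral>\<^sup>+\<omega>. ennreal (?c \<omega> + C) \<partial>M) < \<infinity>"
      using ext_expectation_bounded_below[of ?c C] cC[OF m[OF \<alpha>]] C0
      by (cases "\<integral>\<^sup>+\<omega>. ennreal (?c \<omega> + C) \<partial>M") auto
    then have "integrable M (\<lambda>\<omega>. ?c \<omega> + C)"
    proof (intro integrableI_nonneg)
      show "AE \<omega> in M. 0 \<le> ?c \<omega> + C"
      proof (intro AE_I2)
        fix \<omega> show "0 \<le> ?c \<omega> + C" using cC[OF m[OF \<alpha>], of "(\<xi> \<omega>, \<alpha> \<omega>)" "Z \<omega>"] by linarith
      qed
    qed auto
    then have "integrable M (\<lambda>\<omega>. (?c \<omega> + C) - G (?X \<alpha> \<omega>) m - C)"
      using GX_int[OF \<alpha> m[OF \<alpha>]] by (intro Bochner_Integration.integrable_diff) auto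
    then show ?thesis
      by (rule Bochner_Integration.integrable_cong[THEN iffD1, rotated 2]) (simp_all add: c_eq[OF \<alpha>])
  qed
  \<comment> \<open>The costs are now real numbers, and only the terminal part \<open>g\<close>
    depends on the measure: the running parts cancel when the optimality inequalities are
    added.\<close>
  define l where "l \<alpha> = (\<integral>\<omega>. L' (\<xi> \<omega>, \<alpha> \<omega>) * \<delta> \<partial>M)" for \<alpha>
  define g where "g \<alpha> m = (\<integral>\<omega>. G (?X \<alpha> \<omega>) m \<partial>M)" for \<alpha> m
  have J: "mfg_cost \<delta> M \<xi> Z b L G m' \<alpha> = ereal (l \<alpha> + g \<alpha> m')"
    if \<alpha>: "?mfe \<alpha> m" and m': "m' \<in> prob_moment p" for \<alpha> m m'
  proof -
    have "mfg_cost \<delta> M \<xi> Z b L G m' \<alpha> =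
        ext_expectation M (\<lambda>\<omega>. L' (\<xi> \<omega>, \<alpha> \<omega>) * \<delta> + G (?X \<alpha> \<omega>) m')"
      unfolding cost[OF adm[OF \<alpha>]] using c_eq[OF \<alpha>] by (intro ext_expectation_cong)
    also have "\<dots> = ereal (l \<alpha> + g \<alpha> m')"
      using L_int[OF \<alpha>] GX_int[OF \<alpha> m'] by (subst ext_expectation_integrable) (auto simp: l_def g_def)
    finally show ?thesis .
  qed
  note mm = m[OF mfe(1)] m[OF mfe(2)]
  have minD: "mfg_cost \<delta> M \<xi> Z b L G m \<alpha> \<le> mfg_cost \<delta> M \<xi> Z b L G m \<beta>"
    if "?mfe \<alpha> m" "\<beta> \<in> admissible A p M \<xi>" for \<alpha> \<beta> m
    using min[OF that(1)] that(2) by (auto simp: is_arg_min_def not_less)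
  have "l \<alpha>1 + g \<alpha>1 m1 \<le> l \<alpha>2 + g \<alpha>2 m1"
    using minD[OF mfe(1) adm[OF mfe(2)]] unfolding J[OF mfe(1) mm(1)] J[OF mfe(2) mm(1)] by simp
  moreover have "l \<alpha>2 + g \<alpha>2 m2 \<le> l \<alpha>1 + g \<alpha>1 m2"
    using minD[OF mfe(2) adm[OF mfe(1)]] unfolding J[OF mfe(2) mm(2)] J[OF mfe(1) mm(2)] by simp
  moreover have "(g \<alpha>1 m1 - g \<alpha>1 m2) - (g \<alpha>2 m1 - g \<alpha>2 m2) \<ge> 0"
  proof -
    \<comment> \<open>The consistency condition on the law turns the integrals against
      \<open>m1\<close> and \<open>m2\<close> in the monotonicity condition into expectations over
      the two states.\<close>
    have "(\<integral>x. G x m1 - G x m2 \<partial>m) = g \<alpha> m1 - g \<alpha> m2" if \<alpha>: "?mfe \<alpha> m" for \<alpha> m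
    proof -
      have "(\<integral>x. G x m1 - G x m2 \<partial>m) = (\<integral>\<omega>. G (?X \<alpha> \<omega>) m1 - G (?X \<alpha> \<omega>) m2 \<partial>M)"
        using assms(29)[OF mm(1)] assms(29)[OF mm(2)] state_m[OF adm[OF \<alpha>]]
        by (subst law[OF \<alpha>, symmetric]) (simp add: integral_distr)
      also have "\<dots> = g \<alpha> m1 - g \<alpha> m2"
        unfolding g_def by (intro Bochner_Integration.integral_diff GX_int[OF \<alpha>] mm)
      finally show ?thesis .
    qed
    note G_law = this[OF mfe(1)] this[OF mfe(2)]
    have "(\<integral>x. G x m1 - G x m2 \<partial>m1) - (\<integral>x. G x m1 - G x m2 \<partial>m2) \<ge> 0"
      using assms(31) mm unfolding lasry_lions_monotone_def by blast
    then show ?thesis unfolding G_law .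
  qed
  \<comment> \<open>The two optimality inequalities add up to the reverse of the monotonicity
    inequality, so both are equalities. In particular \<open>\<alpha>2\<close> attains the minimal
    cost against \<open>m1\<close>.\<close>
  ultimately have "l \<alpha>1 + g \<alpha>1 m1 = l \<alpha>2 + g \<alpha>2 m1" by linarith
  then have "mfg_cost \<delta> M \<xi> Z b L G m1 \<alpha>2 = mfg_cost \<delta> M \<xi> Z b L G m1 \<alpha>1"
    unfolding J[OF mfe(1) mm(1)] J[OF mfe(2) mm(1)] by simp
  then have "is_arg_min (mfg_cost \<delta> M \<xi> Z b L G m1) (\<lambda>\<beta>. \<beta> \<in> admissible A p M \<xi>) \<alpha>2"
    using min[OF mfe(1)] adm[OF mfe(2)] by (simp add: is_arg_min_def)
  \<comment> \<open>Both controls minimize \<open>F m1\<close> at almost every initial state, and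
    there the minimizer is unique.\<close>
  from optimal[OF mm(1) min[OF mfe(1)]] optimal[OF mm(1) this]
  have ae: "AE \<omega> in M. \<alpha>1 \<omega> = \<alpha>2 \<omega>"
    by eventually_elim (rule unique[OF mm(1)])
  then have "AE \<omega> in M. ?X \<alpha>1 \<omega> = ?X \<alpha>2 \<omega>"
    by eventually_elim (simp add: controlled_state_def)
  then have "distr M borel (?X \<alpha>1) = distr M borel (?X \<alpha>2)"
    by (intro distr_cong_AE state_m adm[OF mfe(1)] adm[OF mfe(2)] refl)
  then show "(AE \<omega> in M. \<alpha>1 \<omega> = \<alpha>2 \<omega>) \<and> m1 = m2"
    using ae law[OF mfe(1)] law[OF mfe(2)] by simp
qed

end
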